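(* Let $1\le q_1<p<q_2$. Assume that (i) $X$ is an asymptotically $p$-uniformly smooth Banach space with the $p$-co-Banach-Saks property which does not contain $\ell_1$; (ii) $Y_1$ is a Banach space with a $1$-unconditional basis satisfying a lower $\ell_{q_1}$-estimate with constant $1$; and (iii) $Y_2$ is a reflexive asymptotically $q_2$-uniformly smooth Banach space. Then $X$ does not coarse Lipschitz embed into $Y_1\oplus Y_2$.
   Context: A space $Z$ is asymptotically $r$-uniformly smooth if $\overline\rho_Z(t)\le Ct^r$ on $[0,1]$ for some $C$, where $\overline{\rho}_Z(t)=\sup_{z\in\partial B_Z}\inf_{\dim(Z/E)<\infty}\sup_{h\in\partial B_E}\|z+th\|-1$. $X$ has the $p$-co-Banach-Saks property if every semi-normalized weakly null sequence $(x_n)$ has a subsequence $(x_{n_j})$ and $c>0$ with $\|x_{n_{j_1}}+\dots+x_{n_{j_k}}\|\ge ck^{1/p}$ for all $k\le j_1<\dots<j_k$. A $1$-unconditional basis satisfies a lower $\ell_q$-estimate with constant $1$ if $\|y_1+\dots+y_k\|^q\ge\sum\|y_n\|^q$ for disjointly supported $y_n$. A coarse Lipschitz embedding is a map $f$ with $\omega_f(t)\le Lt+L$ and $\rho_f(t)\ge L^{-1}t-L$ for some $L>0$, where $\omega_f(t)=\sup\{\|f(x)-f(y)\|:\|x-y\|\le t\}$, $\rho_f(t)=\inf\{\|f(x)-f(y)\|:\|x-y\|\ge t\}$.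
   Formalization: The formal theorem additionally assumes that X is infinite-dimensional; for finite-dimensional X the hypotheses hold vacuously and X embeds linearly into Y_1, so the statement as written fails. *)

theory Defs
  imports "HOL-Analysis.Analysis"
begin

definition infinite_dimensional :: "'a::real_normed_vector itself \<Rightarrow> bool" where
  "infinite_dimensional _ \<longleftrightarrow> \<not> (\<exists>B::'a set. finite B \<and> span B = UNIV)"

definition fin_codim_subspace :: "'a::real_normed_vector set \<Rightarrow> bool" where
  "fin_codim_subspace E \<longleftrightarrow> subspace E \<and> closed E \<and>
     (\<exists>F. finite F \<and> span (E \<union> F) = UNIV)"

text \<open>Modulus of asymptotic uniform smoothness (extended-real valued, so that
  suprema/infima are always defined).\<close>
definition asym_smooth_modulus :: "'a::real_normed_vector itself \<Rightarrow> real \<Rightarrow> ereal" where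
  "asym_smooth_modulus _ t =
     (SUP z\<in>{z::'a. norm z = 1}.
        (INF E\<in>{E::'a set. fin_codim_subspace E}.
           (SUP h\<in>{h\<in>E. norm h = 1}. ereal (norm (z + t *\<^sub>R h))))) - 1"

definition asymptotically_uniformly_smooth_power :: "'a::real_normed_vector itself \<Rightarrow> real \<Rightarrow> bool" where
  "asymptotically_uniformly_smooth_power Z r \<longleftrightarrow>
     (\<exists>C. \<forall>t\<in>{0..1}. asym_smooth_modulus Z t \<le> ereal (C * t powr r))"

definition weakly_null :: "(nat \<Rightarrow> 'a::real_normed_vector) \<Rightarrow> bool" where
  "weakly_null x \<longleftrightarrow> (\<forall>f::'a \<Rightarrow>\<^sub>L real. (\<lambda>n. blinfun_apply f (x n)) \<longlonglongrightarrow> 0)"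

definition semi_normalized :: "(nat \<Rightarrow> 'a::real_normed_vector) \<Rightarrow> bool" where
  "semi_normalized x \<longleftrightarrow> (\<exists>a b. 0 < a \<and> (\<forall>n. a \<le> norm (x n) \<and> norm (x n) \<le> b))"

text \<open>p-co-Banach-Saks property. The subsequence is (x (\<sigma> j)) for j \<ge> 1; a finite
  set F of indices j_1<...<j_k with k \<le> j_1 is any finite F with card F \<le> j for all j in F.\<close>
definition co_banach_saks :: "'a::real_normed_vector itself \<Rightarrow> real \<Rightarrow> bool" where
  "co_banach_saks _ p \<longleftrightarrow>
     (\<forall>x::nat \<Rightarrow> 'a. semi_normalized x \<and> weakly_null x \<longrightarrow>
        (\<exists>\<sigma> c. strict_mono \<sigma> \<and> c > 0 \<and>
           (\<forall>F. finite F \<and> (\<forall>j\<in>F. card F \<le> j) \<longrightarrow>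
              norm (\<Sum>j\<in>F. x (\<sigma> j)) \<ge> c * real (card F) powr (1/p))))"

text \<open>X contains (an isomorphic copy of) \<ell>_1: some sequence is equivalent to the unit
  vector basis of \<ell>_1.\<close>
definition contains_l1 :: "'a::real_normed_vector itself \<Rightarrow> bool" where
  "contains_l1 _ \<longleftrightarrow>
     (\<exists>(x::nat \<Rightarrow> 'a) a b. 0 < a \<and>
        (\<forall>n c. a * (\<Sum>i<n. \<bar>c i\<bar>) \<le> norm (\<Sum>i<n. c i *\<^sub>R x i) \<and>
               norm (\<Sum>i<n. c i *\<^sub>R x i) \<le> b * (\<Sum>i<n. \<bar>c i\<bar>)))"

definition schauder_basis :: "(nat \<Rightarrow> 'a::real_normed_vector) \<Rightarrow> bool" where
  "schauder_basis e \<longleftrightarrow>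
     (\<forall>y. \<exists>!a::nat \<Rightarrow> real. (\<lambda>n. \<Sum>i<n. a i *\<^sub>R e i) \<longlonglongrightarrow> y)"

definition basis_coeffs :: "(nat \<Rightarrow> 'a::real_normed_vector) \<Rightarrow> 'a \<Rightarrow> nat \<Rightarrow> real" where
  "basis_coeffs e y = (THE a. (\<lambda>n. \<Sum>i<n. a i *\<^sub>R e i) \<longlonglongrightarrow> y)"

definition basis_support :: "(nat \<Rightarrow> 'a::real_normed_vector) \<Rightarrow> 'a \<Rightarrow> nat set" where
  "basis_support e y = {n. basis_coeffs e y n \<noteq> 0}"

definition one_unconditional_basis :: "(nat \<Rightarrow> 'a::real_normed_vector) \<Rightarrow> bool" where
  "one_unconditional_basis e \<longleftrightarrow> schauder_basis e \<and>
     (\<forall>n (a::nat \<Rightarrow> real) (\<epsilon>::nat \<Rightarrow> real). (\<forall>i. \<bar>\<epsilon> i\<bar> = 1) \<longrightarrow>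
        norm (\<Sum>i<n. (\<epsilon> i * a i) *\<^sub>R e i) \<le> norm (\<Sum>i<n. a i *\<^sub>R e i))"

definition lower_estimate_const1 :: "(nat \<Rightarrow> 'a::real_normed_vector) \<Rightarrow> real \<Rightarrow> bool" where
  "lower_estimate_const1 e q \<longleftrightarrow>
     (\<forall>k (y::nat \<Rightarrow> 'a).
        (\<forall>i<k. \<forall>j<k. i \<noteq> j \<longrightarrow> basis_support e (y i) \<inter> basis_support e (y j) = {}) \<longrightarrow>
        norm (\<Sum>i<k. y i) powr q \<ge> (\<Sum>i<k. norm (y i) powr q))"

definition reflexive :: "'a::real_normed_vector itself \<Rightarrow> bool" where
  "reflexive _ \<longleftrightarrow>
     (\<forall>\<phi>::('a \<Rightarrow>\<^sub>L real) \<Rightarrow>\<^sub>L real. \<exists>x::'a. \<forall>f. blinfun_apply \<phi> f = blinfun_apply f x)"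

definition omega_f :: "('a::real_normed_vector \<Rightarrow> 'b::real_normed_vector) \<Rightarrow> real \<Rightarrow> ereal" where
  "omega_f f t = (SUP xy\<in>{(x,y). norm (x - y) \<le> t}. ereal (norm (f (fst xy) - f (snd xy))))"

definition rho_f :: "('a::real_normed_vector \<Rightarrow> 'b::real_normed_vector) \<Rightarrow> real \<Rightarrow> ereal" where
  "rho_f f t = (INF xy\<in>{(x,y). norm (x - y) \<ge> t}. ereal (norm (f (fst xy) - f (snd xy))))"

definition coarse_lipschitz_embedding :: "('a::real_normed_vector \<Rightarrow> 'b::real_normed_vector) \<Rightarrow> bool" where
  "coarse_lipschitz_embedding f \<longleftrightarrow>
     (\<exists>L>0. \<forall>t\<ge>0. omega_f f t \<le> ereal (L * t + L) \<and> rho_f f t \<ge> ereal (t / L - L))"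

end

theory Submission
  imports Defs
begin

text \<open>
  Let \<open>f = (f\<^sub>1, f\<^sub>2)\<close> be a coarse Lipschitz embedding.  Pairs of far-apart points that nearly attain the
  Lipschitz constant of \<open>f\<^sub>1\<close> at infinity have their approximate midpoints mapped to approximate
  midpoints.  In \<open>X\<close> the approximate midpoints contain a ball of a finite-codimensional subspace \<open>E\<close>
  of radius of order \<open>\<delta>\<^bsup>1/p\<^esup>\<close>, while in \<open>Y\<^sub>1\<close> they lie within order \<open>\<delta>\<^bsup>1/q\<^sub>1\<^esup>\<close> of a compact set;
  since \<open>q\<^sub>1 < p\<close>, \<open>f\<^sub>1\<close> is almost compact-valued on some large ball \<open>u + \<tau> B\<^sub>E\<close>.

  In that ball one considers \<open>\<psi>(n\<^sub>1,\<dots>,n\<^sub>k) = u + r (y\<^bsub>n\<^sub>1\<^esub> + \<dots> + y\<^bsub>n\<^sub>k\<^esub>)\<close> with \<open>(y\<^sub>n)\<close> weakly null in \<open>E\<close>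
  and \<open>r\<close> of order \<open>\<tau> k\<^bsup>-1/p\<^esup>\<close>.  Asymptotic smoothness keeps the values in the ball, and \<open>f\<^sub>2 \<circ> \<psi>\<close>
  concentrates to within order \<open>r k\<^bsup>1/q\<^sub>2\<^esup> \<ll> \<tau>\<close> of a point, by a Kalton--Randrianarivony argument.
  Thus \<open>f \<circ> \<psi>\<close> is generically almost constant on the scale \<open>\<tau>\<close>, although the co-Banach--Saks
  property spreads the values of \<open>\<psi>\<close> by a fixed multiple of \<open>\<tau>\<close>.

  ``Generically'' refers throughout to iterates of a free ultrafilter, which replaces Ramsey's theorem
  and the passage to subsequences.  The weakly null sequence in \<open>X\<close> comes from asymptotic smoothness: unit
  vectors chosen successively in suitable finite-codimensional subspaces satisfy an upper \<open>p\<close>-estimate,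
  which forces them to be weakly null because \<open>p > 1\<close>.
\<close>

subsection \<open>Norming functionals and ultrafilter limits\<close>

text \<open>Zorn's lemma for the reversed order, serving both Hahn-Banach and the existence of
  ultrafilters. The element \<open>a0\<close> bounds the empty chain.\<close>

lemma minimal_element_exists:
  fixes A :: "'a::order set"
  assumes "a0 \<in> A"
    and lb: "\<And>C. C \<subseteq> A \<Longrightarrow> C \<noteq> {} \<Longrightarrow> (\<And>x y. x \<in> C \<Longrightarrow> y \<in> C \<Longrightarrow> x \<le> y \<or> y \<le> x) \<Longrightarrow> \<exists>u\<in>A. \<forall>a\<in>C. u \<le> a"
  shows "\<exists>m\<in>A. \<forall>a\<in>A. a \<le> m \<longrightarrow> a = m"
proof (rule predicate_Zorn)
  show "partial_order_on A (relation_of (\<lambda>x y. y \<le> x) A)"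
    by (rule partial_order_on_relation_ofI) auto
next
  fix C assume C: "C \<in> Chains (relation_of (\<lambda>x y. y \<le> x) A)"
  have "C \<subseteq> A" using C by (rule Chains_relation_of)
  moreover have "x \<le> y \<or> y \<le> x" if "x \<in> C" "y \<in> C" for x y
    using C that unfolding Chains_def relation_of_def by blast
  ultimately show "\<exists>u\<in>A. \<forall>a\<in>C. u \<le> a"
    using lb[of C] \<open>a0 \<in> A\<close> by (cases "C = {}") auto
qed

definition sublinear :: "('a::real_vector \<Rightarrow> real) \<Rightarrow> bool" where
  "sublinear p \<longleftrightarrow> (\<forall>x y. p (x + y) \<le> p x + p y) \<and> (\<forall>c x. 0 \<le> c \<longrightarrow> p (c *\<^sub>R x) = c * p x)"

lemma sublinear_add: "sublinear p \<Longrightarrow> p (x + y) \<le> p x + p y"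
  by (simp add: sublinear_def)

lemma sublinear_scale: "sublinear p \<Longrightarrow> 0 \<le> c \<Longrightarrow> p (c *\<^sub>R x) = c * p x"
  by (simp add: sublinear_def)

lemma sublinear_zero: "sublinear p \<Longrightarrow> p 0 = 0"
  using sublinear_scale[of p 0 0] by simp

lemma sublinear_ge_neg: "sublinear p \<Longrightarrow> - p (- x) \<le> p x"
  using sublinear_add[of p x "- x"] sublinear_zero[of p] by simp

lemma sublinearI:
  assumes "\<And>x y. p (x + y) \<le> p x + p y" "p 0 = 0"
    and "\<And>c x. 0 < c \<Longrightarrow> p (c *\<^sub>R x) \<le> c * p x"
  shows "sublinear p"
  unfolding sublinear_def
proof (intro conjI allI impI)
  fix c :: real and x assume "0 \<le> c"
  show "p (c *\<^sub>R x) = c * p x"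
  proof (cases "c = 0")
    case False
    hence c: "0 < c" using \<open>0 \<le> c\<close> by simp
    have "p (inverse c *\<^sub>R (c *\<^sub>R x)) \<le> inverse c * p (c *\<^sub>R x)"
      using assms(3) c by (metis positive_imp_inverse_positive)
    hence "c * p x \<le> p (c *\<^sub>R x)" using c by (simp add: field_simps)
    with assms(3)[OF c, of x] show ?thesis by simp
  qed (simp add: assms(2))
qed (rule assms(1))

text \<open>The infimum of \<open>p (z + t *\<^sub>R y) - t * p y\<close> over
  \<open>t \<ge> 0\<close> works; the two bounds are the cases \<open>t = 0\<close> and
  \<open>t = 1\<close>. At \<open>z = - y\<close> the second one reads
  \<open>p' (- y) \<le> - p y\<close>, so a linear functional below \<open>p'\<close> agrees with
  \<open>p\<close> at \<open>y\<close>.\<close>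

lemma sublinear_lower:
  fixes p :: "'a::real_vector \<Rightarrow> real"
  assumes p: "sublinear p"
  obtains p' where "sublinear p'" "\<And>z. p' z \<le> p z" "\<And>z. p' z \<le> p (z + y) - p y"
proof -
  define h where "h z t = p (z + t *\<^sub>R y) - t * p y" for z t
  define p' where "p' z = (INF t\<in>{0..}. h z t)" for z
  have below: "- p (- z) \<le> h z t" if "t \<ge> 0" for z t
  proof -
    have "p (t *\<^sub>R y) \<le> p (z + t *\<^sub>R y) + p (- z)"
      using sublinear_add[OF p, of "z + t *\<^sub>R y" "- z"] by simp
    thus ?thesis using sublinear_scale[OF p that, of y] by (simp add: h_def)
  qed
  have bdd: "bdd_below (h z ` {0..})" for z
    using below by (intro bdd_belowI[of _ "- p (- z)"]) auto
  have le: "p' z \<le> h z t" if "t \<ge> 0" for z t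
    unfolding p'_def using that by (intro cINF_lower bdd) auto
  have ge: "c \<le> p' z" if "\<And>t. t \<ge> 0 \<Longrightarrow> c \<le> h z t" for z c
    unfolding p'_def using that by (intro cINF_greatest) auto
  have "sublinear p'"
  proof (rule sublinearI)
    fix x z
    have "p' (x + z) - h x s \<le> h z t" if "s \<ge> 0" "t \<ge> 0" for s t
    proof -
      have "h (x + z) (s + t) \<le> h x s + h z t"
        using sublinear_add[OF p, of "x + s *\<^sub>R y" "z + t *\<^sub>R y"]
        by (simp add: h_def algebra_simps)
      thus ?thesis using le[of "s + t" "x + z"] that by simp
    qed
    hence "p' (x + z) - h x s \<le> p' z" if "s \<ge> 0" for s using that by (intro ge) auto
    hence "p' (x + z) - p' z \<le> p' x" by (intro ge) (simp add: algebra_simps)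
    thus "p' (x + z) \<le> p' x + p' z" by simp
  next
    have "h 0 t = 0" if "t \<ge> 0" for t using sublinear_scale[OF p that] by (simp add: h_def)
    thus "p' 0 = 0" using le[of 0 0] ge[of 0 0] by simp
  next
    fix c :: real and x assume c: "0 < c"
    have "p' (c *\<^sub>R x) / c \<le> h x t" if "t \<ge> 0" for t
    proof -
      have "h (c *\<^sub>R x) (c * t) = c * h x t"
        using sublinear_scale[OF p, of c "x + t *\<^sub>R y"] c by (simp add: h_def algebra_simps)
      thus ?thesis using le[of "c * t" "c *\<^sub>R x"] that c by (simp add: field_simps)
    qed
    hence "p' (c *\<^sub>R x) / c \<le> p' x" by (rule ge)
    thus "p' (c *\<^sub>R x) \<le> c * p' x" using c by (simp add: field_simps)
  qed
  moreover have "p' z \<le> p z" for z using le[of 0 z] by (simp add: h_def)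
  moreover have "p' z \<le> p (z + y) - p y" for z using le[of 1 z] by (simp add: h_def)
  ultimately show ?thesis by (rule that)
qed

text \<open>Subadditivity is where the chain condition enters: the smaller of two members, evaluated
  at \<open>x\<close> and at \<open>y\<close>, lies below both.\<close>

lemma sublinear_Inf_chain:
  fixes C :: "('a::real_vector \<Rightarrow> real) set"
  assumes "C \<noteq> {}" and sub: "\<And>p. p \<in> C \<Longrightarrow> sublinear p"
    and chain: "\<And>p q. p \<in> C \<Longrightarrow> q \<in> C \<Longrightarrow> p \<le> q \<or> q \<le> p"
    and bound: "\<And>p x. p \<in> C \<Longrightarrow> b x \<le> p x"
  shows "sublinear (\<lambda>x. INF p\<in>C. p x)"
proof -
  have bdd: "bdd_below ((\<lambda>p. p x) ` C)" for x
    using bound by (intro bdd_belowI[of _ "b x"]) auto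
  let ?u = "\<lambda>x. INF p\<in>C. p x"
  have le: "?u x \<le> p x" if "p \<in> C" for p x using that by (intro cINF_lower bdd)
  have ge: "c \<le> ?u x" if "\<And>p. p \<in> C \<Longrightarrow> c \<le> p x" for c x
    using that assms(1) by (intro cINF_greatest)
  show ?thesis
  proof (rule sublinearI)
    fix x y
    have "?u (x + y) - p x \<le> q y" if pq: "p \<in> C" "q \<in> C" for p q
    proof -
      obtain r where r: "r \<in> C" "r \<le> p" "r \<le> q" using chain[OF pq] pq by blast
      have "?u (x + y) \<le> r x + r y"
        using le[OF r(1), of "x + y"] sublinear_add[OF sub[OF r(1)], of x y] by simp
      also have "\<dots> \<le> p x + q y" using r by (intro add_mono) (auto simp: le_fun_def)
      finally show ?thesis by simp
    qed
    hence "?u (x + y) - p x \<le> ?u y" if "p \<in> C" for p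
      using that by (intro ge)
    hence "?u (x + y) - ?u y \<le> ?u x" by (intro ge) (simp add: diff_le_eq add.commute)
    thus "?u (x + y) \<le> ?u x + ?u y" by simp
  next
    have "p 0 = 0" if "p \<in> C" for p using sublinear_zero[OF sub[OF that]] .
    hence "(\<lambda>p. p 0) ` C = {0}" using assms(1) by force
    thus "?u 0 = 0" by simp
  next
    fix c :: real and x assume c: "0 < c"
    have "?u (c *\<^sub>R x) / c \<le> ?u x"
    proof (rule ge)
      fix p assume "p \<in> C"
      thus "?u (c *\<^sub>R x) / c \<le> p x"
        using le[of p "c *\<^sub>R x"] sublinear_scale[OF sub, of p c x] c by (simp add: field_simps)
    qed
    thus "?u (c *\<^sub>R x) \<le> c * ?u x" using c by (simp add: field_simps)
  qed
qed

text \<open>Hahn--Banach: a minimal sublinear functional is linear, since otherwise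
  \<open>sublinear_lower\<close> would produce a smaller one.\<close>

lemma sublinear_dominates_linear:
  fixes p0 :: "'a::real_vector \<Rightarrow> real"
  assumes p0: "sublinear p0"
  obtains g where "linear g" "\<And>x. g x \<le> p0 x"
proof -
  let ?A = "{p. sublinear p \<and> p \<le> p0}"
  have lower: "- p0 (- x) \<le> p x" if "p \<in> ?A" for p x
    using sublinear_ge_neg[of p x] that by (auto simp: le_fun_def intro: order_trans[rotated])
  have "\<exists>m\<in>?A. \<forall>a\<in>?A. a \<le> m \<longrightarrow> a = m"
  proof (rule minimal_element_exists)
    fix C assume C: "C \<subseteq> ?A" "C \<noteq> {}" "\<And>x y. x \<in> C \<Longrightarrow> y \<in> C \<Longrightarrow> x \<le> y \<or> y \<le> x"
    let ?u = "\<lambda>x. INF p\<in>C. p x"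
    have bdd: "bdd_below ((\<lambda>p. p x) ` C)" for x
      using lower C(1) by (intro bdd_belowI[of _ "- p0 (- x)"]) auto
    have le: "?u \<le> p" if "p \<in> C" for p
      unfolding le_fun_def using that by (intro allI cINF_lower bdd)
    have "sublinear ?u"
      using C lower by (intro sublinear_Inf_chain[where b = "\<lambda>x. - p0 (- x)"]) auto
    moreover have "?u \<le> p0" proof -
      obtain p where "p \<in> C" using C(2) by blast
      thus ?thesis using le[of p] C(1) order_trans[of ?u p p0] by blast
    qed
    ultimately show "\<exists>u\<in>?A. \<forall>a\<in>C. u \<le> a" using le by blast
  next
    show "p0 \<in> ?A" using p0 by simp
  qed
  then obtain m where m: "sublinear m" "m \<le> p0"
    and min: "\<And>a. sublinear a \<Longrightarrow> a \<le> m \<Longrightarrow> a = m"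
    by (auto intro: order_trans)
  \<comment> \<open>Minimality gives \<open>p' = m\<close>, and the second bound on
    \<open>p'\<close> becomes the converse of subadditivity.\<close>
  have add: "m (x + y) = m x + m y" for x y
  proof -
    obtain p' where p': "sublinear p'" "\<And>z. p' z \<le> m z" "\<And>z. p' z \<le> m (z + y) - m y"
      using sublinear_lower[OF m(1)] by metis
    have "p' = m" using min p' by (simp add: le_fun_def)
    thus ?thesis using p'(3)[of x] sublinear_add[OF m(1), of x y] by simp
  qed
  have neg: "m (- x) = - m x" for x
    using add[of x "- x"] sublinear_zero[OF m(1)] by simp
  have "linear m"
  proof (rule linearI[OF add])
    fix c :: real and x
    show "m (c *\<^sub>R x) = c *\<^sub>R m x"
      using sublinear_scale[OF m(1), of c x] sublinear_scale[OF m(1), of "- c" x] neg[of "c *\<^sub>R x"]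
      by (cases "c \<ge> 0") auto
  qed
  thus ?thesis using m(2) by (intro that) (auto simp: le_fun_def)
qed

text \<open>Lowering the norm in the direction \<open>x\<close> before linearizing forces
  \<open>g (- x) \<le> - norm x\<close>; this replaces the extension of a functional from the line
  through \<open>x\<close>.\<close>

lemma norming_functional:
  fixes x :: "'a::real_normed_vector"
  obtains g :: "'a \<Rightarrow>\<^sub>L real" where "\<And>z. \<bar>blinfun_apply g z\<bar> \<le> norm z" "blinfun_apply g x = norm x"
proof -
  have "sublinear (norm :: 'a \<Rightarrow> real)" by (simp add: sublinear_def norm_triangle_ineq)
  then obtain p' where p': "sublinear p'" "\<And>z. p' z \<le> norm z" "\<And>z. p' z \<le> norm (z + x) - norm x"
    using sublinear_lower by metis
  then obtain g where g: "linear g" "\<And>z. g z \<le> p' z"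
    using sublinear_dominates_linear by metis
  have le: "\<bar>g z\<bar> \<le> norm z" for z
    using g(2)[of z] g(2)[of "- z"] p'(2)[of z] p'(2)[of "- z"] linear_neg[OF g(1), of z] by simp
  have "bounded_linear g"
    using le by (intro bounded_linear_intro[of g 1]) (simp_all add: linear_add[OF g(1)] linear_scale[OF g(1)])
  moreover have "g x = norm x"
    using g(2)[of "- x"] p'(3)[of "- x"] linear_neg[OF g(1), of x] le[of x] by simp
  ultimately show ?thesis
    using le by (intro that[of "Blinfun g"]) (simp_all add: bounded_linear_Blinfun_apply)
qed

text \<open>Finer filters are smaller: \<open>F \<le> sequentially\<close> makes every cofinite set
  large, which is nonprincipality.\<close>

definition free_ultrafilter :: "nat filter \<Rightarrow> bool" where
  "free_ultrafilter F \<longleftrightarrow> F \<noteq> bot \<and> F \<le> sequentially \<and>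
     (\<forall>P. eventually P F \<or> eventually (\<lambda>n. \<not> P n) F)"

text \<open>A minimal proper filter is an ultrafilter, since restricting it to
  \<open>{n. P n}\<close> gives either \<open>bot\<close> or the filter itself. Chains of proper
  filters have a proper infimum because an event of the infimum is already one of some
  member.\<close>

lemma free_ultrafilter_exists: "\<exists>F. free_ultrafilter F"
proof -
  let ?A = "{F::nat filter. F \<noteq> bot \<and> F \<le> sequentially}"
  have "\<exists>m\<in>?A. \<forall>a\<in>?A. a \<le> m \<longrightarrow> a = m"
  proof (rule minimal_element_exists)
    fix C assume C: "C \<subseteq> ?A" "C \<noteq> {}" "\<And>x y. x \<in> C \<Longrightarrow> y \<in> C \<Longrightarrow> x \<le> y \<or> y \<le> x"
    have "eventually P (Inf C) \<longleftrightarrow> (\<exists>b\<in>C. eventually P b)" for P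
    proof (intro eventually_Inf_base C(2))
      fix x y assume "x \<in> C" "y \<in> C"
      thus "\<exists>z\<in>C. z \<le> inf x y" using C(3)[of x y] by (auto simp: le_inf_iff)
    qed
    hence "Inf C \<noteq> bot" using C(1) by (auto simp: trivial_limit_def)
    moreover have "Inf C \<le> sequentially" using C(1,2) by (auto intro: Inf_lower2)
    ultimately show "\<exists>u\<in>?A. \<forall>a\<in>C. u \<le> a" by (intro bexI[of _ "Inf C"]) (auto intro: Inf_lower)
  next
    show "sequentially \<in> ?A" by simp
  qed
  then obtain F where F: "F \<noteq> bot" "F \<le> sequentially"
    and min: "\<And>G. G \<noteq> bot \<Longrightarrow> G \<le> F \<Longrightarrow> G = F" by (auto intro: order_trans)
  have "eventually P F \<or> eventually (\<lambda>n. \<not> P n) F" for P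
  proof (cases "inf F (principal {n. P n}) = bot")
    case True
    hence "eventually (\<lambda>n. False) (inf F (principal {n. P n}))" by simp
    thus ?thesis by (simp add: eventually_inf_principal)
  next
    case False
    hence "inf F (principal {n. P n}) = F" by (intro min) auto
    moreover have "eventually P (inf F (principal {n. P n}))"
      by (simp add: eventually_inf_principal)
    ultimately show ?thesis by simp
  qed
  thus ?thesis using F by (auto simp: free_ultrafilter_def)
qed

text \<open>Compactness of \<open>{-B..B}\<close> gives a cluster point, and the ultrafilter
  dichotomy turns it into a limit.\<close>

lemma ultrafilter_limit:
  fixes f :: "nat \<Rightarrow> real"
  assumes F: "free_ultrafilter F" and bound: "\<And>n. \<bar>f n\<bar> \<le> B"
  shows "\<exists>l. (f \<longlongrightarrow> l) F"
proof -
  have "filtermap f F \<noteq> bot" using F by (simp add: free_ultrafilter_def filtermap_bot_iff)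
  moreover have "eventually (\<lambda>x. x \<in> {-B..B}) (filtermap f F)"
    using bound by (simp add: eventually_filtermap abs_le_iff minus_le_iff)
  ultimately obtain l where l: "inf (nhds l) (filtermap f F) \<noteq> bot"
    using compact_Icc[of "-B" B] unfolding compact_filter by blast
  have "(f \<longlongrightarrow> l) F"
  proof (rule topological_tendstoI)
    fix S assume S: "open S" "l \<in> S"
    have "\<not> eventually (\<lambda>n. \<not> f n \<in> S) F"
    proof
      assume "eventually (\<lambda>n. \<not> f n \<in> S) F"
      hence "eventually (\<lambda>x. x \<notin> S) (filtermap f F)" by (simp add: eventually_filtermap)
      moreover have "eventually (\<lambda>x. x \<in> S) (nhds l)" using S by (rule eventually_nhds_in_open)
      ultimately have "eventually (\<lambda>x. False) (inf (nhds l) (filtermap f F))"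
        by (auto simp: eventually_inf)
      thus False using l by (simp add: trivial_limit_def)
    qed
    thus "eventually (\<lambda>n. f n \<in> S) F" using F by (auto simp: free_ultrafilter_def)
  qed
  thus ?thesis by blast
qed

subsection \<open>Subspaces of finite codimension\<close>

lemma span_insert_decompose:
  fixes E :: "'a::real_vector set"
  assumes "subspace E"
  shows "x \<in> span (insert v E) \<longleftrightarrow> (\<exists>c. x - c *\<^sub>R v \<in> E)"
proof -
  have "span E = E" using assms by (simp add: span_eq_iff)
  thus ?thesis by (simp only: span_insert mem_Collect_eq)
qed

text \<open>Absorbing the spanning vectors into \<open>E\<close> one at a time reduces the claim to
  a single \<open>v\<close>: passing from \<open>span (insert v E)\<close> back to \<open>E\<close>
  costs \<open>S\<close> at most one dimension.\<close>

lemma inter_fin_codim_infinite_dim: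
  fixes S E :: "'a::real_vector set"
  assumes "finite F" "subspace S" "\<And>G. finite G \<Longrightarrow> \<not> S \<subseteq> span G"
    and "subspace E" "S \<subseteq> span (E \<union> F)" "finite G"
  shows "\<not> S \<inter> E \<subseteq> span G"
  using assms(1,4-)
proof (induction F arbitrary: E G)
  case empty
  hence "S \<subseteq> E" by (metis span_eq_iff Un_empty_right)
  thus ?case using assms(3)[OF \<open>finite G\<close>] by blast
next
  case (insert v F)
  let ?E' = "span (insert v E)"
  have "E \<union> insert v F \<subseteq> ?E' \<union> F" using span_superset[of "insert v E"] by blast
  hence S: "S \<subseteq> span (?E' \<union> F)" using insert.prems(2) span_mono by blast
  have IH: "\<not> S \<inter> ?E' \<subseteq> span G" if "finite G" for G
    using insert.IH[of ?E' G] S that by simp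
  show ?case
  proof
    assume sub: "S \<inter> E \<subseteq> span G"
    show False
    proof (cases "S \<inter> ?E' \<subseteq> E")
      case True
      thus False using IH[OF \<open>finite G\<close>] sub by blast
    next
      case False
      then obtain s0 where s0: "s0 \<in> S" "s0 \<in> ?E'" "s0 \<notin> E" by blast
      then obtain c0 where c0: "s0 - c0 *\<^sub>R v \<in> E"
        using span_insert_decompose[OF \<open>subspace E\<close>] by blast
      have "c0 \<noteq> 0" using c0 s0 by auto
      \<comment> \<open>Modulo \<open>E\<close>, every element of \<open>?E'\<close> is a multiple
        of \<open>v\<close>, hence of \<open>s0\<close>, so \<open>s0\<close> is the one direction
        that \<open>span G\<close> may miss.\<close>
      have "S \<inter> ?E' \<subseteq> span (insert s0 G)"
      proof
        fix s assume s: "s \<in> S \<inter> ?E'"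
        then obtain c where c: "s - c *\<^sub>R v \<in> E"
          using span_insert_decompose[OF \<open>subspace E\<close>] by blast
        have "s - (c / c0) *\<^sub>R s0 = (s - c *\<^sub>R v) - (c / c0) *\<^sub>R (s0 - c0 *\<^sub>R v)"
          using \<open>c0 \<noteq> 0\<close> by (simp add: algebra_simps)
        hence "s - (c / c0) *\<^sub>R s0 \<in> E"
          using c c0 \<open>subspace E\<close> by (metis subspace_diff subspace_scale)
        moreover have "s - (c / c0) *\<^sub>R s0 \<in> S"
          using s s0 \<open>subspace S\<close> by (simp add: subspace_diff subspace_scale)
        ultimately have "s - (c / c0) *\<^sub>R s0 \<in> span G" using sub by blast
        thus "s \<in> span (insert s0 G)" by (auto simp: span_insert)
      qed
      thus False using IH[of "insert s0 G"] \<open>finite G\<close> by blast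
    qed
  qed
qed

lemma fin_codim_Inter_unit_vector:
  fixes \<E> :: "'a::real_normed_vector set set"
  assumes inf: "infinite_dimensional TYPE('a)" and "finite \<E>" and "\<And>E. E \<in> \<E> \<Longrightarrow> fin_codim_subspace E"
  obtains x where "norm x = 1" "\<And>E. E \<in> \<E> \<Longrightarrow> x \<in> E"
proof -
  have "subspace (\<Inter>\<E>) \<and> (\<forall>G. finite G \<longrightarrow> \<not> \<Inter>\<E> \<subseteq> span G)"
    using assms(2,3)
  proof (induction \<E>)
    case empty
    thus ?case using inf by (auto simp: infinite_dimensional_def)
  next
    case (insert E \<E>)
    obtain F where F: "finite F" "span (E \<union> F) = UNIV" "subspace E"
      using insert.prems[of E] by (auto simp: fin_codim_subspace_def)
    have "\<not> \<Inter>\<E> \<inter> E \<subseteq> span G" if "finite G" for G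
      using insert that F by (intro inter_fin_codim_infinite_dim[of F]) auto
    thus ?case using insert F by (auto simp: subspace_inter Int_commute)
  qed
  hence sub: "subspace (\<Inter>\<E>)" and "\<not> \<Inter>\<E> \<subseteq> span {}" using finite.emptyI by blast+
  then obtain x where x: "x \<in> \<Inter>\<E>" "x \<noteq> 0" by auto
  have "x /\<^sub>R norm x \<in> \<Inter>\<E>" using sub x by (simp only: subspace_scale)
  thus ?thesis using x by (intro that[of "x /\<^sub>R norm x"]) auto
qed

text \<open>The vector \<open>v\<close> has positive distance \<open>\<delta>\<close> from the
  closed subspace, which bounds its coefficient. Linearity of \<open>c\<close> is encoded in the
  uniqueness clause \<open>c x = k\<close>.\<close>

lemma closed_subspace_insert_coordinate:
  fixes E :: "'a::real_normed_vector set"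
  assumes E: "subspace E" "closed E" and v: "v \<notin> E"
  obtains \<delta> c where "\<delta> > 0" "\<And>x. x \<in> span (insert v E) \<Longrightarrow> x - c x *\<^sub>R v \<in> E"
    "\<And>x k. x - k *\<^sub>R v \<in> E \<Longrightarrow> c x = k" "\<And>x. x \<in> span (insert v E) \<Longrightarrow> \<bar>c x\<bar> * \<delta> \<le> norm x"
proof -
  obtain \<delta> where \<delta>: "\<delta> > 0" "\<And>y. y \<in> E \<Longrightarrow> \<delta> \<le> dist v y"
  proof -
    obtain \<delta> where "\<delta> > 0" "ball v \<delta> \<subseteq> - E"
      using E(2) v by (metis ComplI open_Compl open_contains_ball)
    thus ?thesis by (intro that[of \<delta>]) (auto simp: subset_eq not_less[symmetric])
  qed
  define c where "c x = (THE k. x - k *\<^sub>R v \<in> E)" for x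
  have uniq: "k = k'" if "x - k *\<^sub>R v \<in> E" "x - k' *\<^sub>R v \<in> E" for x k k'
  proof (rule ccontr)
    assume "k \<noteq> k'"
    have "(x - k' *\<^sub>R v) - (x - k *\<^sub>R v) = (k - k') *\<^sub>R v" by (simp add: algebra_simps)
    hence "(k - k') *\<^sub>R v \<in> E" using that E(1) by (metis subspace_diff)
    hence "inverse (k - k') *\<^sub>R ((k - k') *\<^sub>R v) \<in> E" by (rule subspace_scale[OF E(1)])
    thus False using v \<open>k \<noteq> k'\<close> by simp
  qed
  have c: "c x = k" if "x - k *\<^sub>R v \<in> E" for x k
    unfolding c_def using that uniq by blast
  have mem: "x - c x *\<^sub>R v \<in> E" if "x \<in> span (insert v E)" for x
    using that span_insert_decompose[OF E(1)] c by blast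
  have "\<bar>c x\<bar> * \<delta> \<le> norm x" if "x \<in> span (insert v E)" for x
  proof (cases "c x = 0")
    case False
    have "(- inverse (c x)) *\<^sub>R (x - c x *\<^sub>R v) \<in> E" by (rule subspace_scale[OF E(1) mem[OF that]])
    hence "\<delta> \<le> norm (v - (- inverse (c x)) *\<^sub>R (x - c x *\<^sub>R v))" using \<delta>(2) unfolding dist_norm by blast
    also have "v - (- inverse (c x)) *\<^sub>R (x - c x *\<^sub>R v) = inverse (c x) *\<^sub>R x"
      using False by (simp add: algebra_simps)
    finally show ?thesis using False by (simp add: field_simps)
  qed simp
  with \<delta>(1) mem c show ?thesis by (rule that)
qed

text \<open>The coefficients of \<open>v\<close> along a convergent sequence are Cauchy, so
  coefficient and remainder in \<open>E\<close> converge separately.\<close>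

lemma closed_span_insert:
  fixes E :: "'a::banach set"
  assumes E: "subspace E" "closed E"
  shows "closed (span (insert v E))"
proof (cases "v \<in> E")
  case True
  thus ?thesis using E by (metis insert_absorb span_eq_iff)
next
  case False
  obtain \<delta> c where c: "\<delta> > 0" "\<And>x. x \<in> span (insert v E) \<Longrightarrow> x - c x *\<^sub>R v \<in> E"
    "\<And>x k. x - k *\<^sub>R v \<in> E \<Longrightarrow> c x = k" "\<And>x. x \<in> span (insert v E) \<Longrightarrow> \<bar>c x\<bar> * \<delta> \<le> norm x"
    by (rule closed_subspace_insert_coordinate[OF E False]) (rule that)
  have diff: "c (x - y) = c x - c y" if "x \<in> span (insert v E)" "y \<in> span (insert v E)" for x y
  proof (rule c(3))
    have "x - y - (c x - c y) *\<^sub>R v = (x - c x *\<^sub>R v) - (y - c y *\<^sub>R v)" by (simp add: algebra_simps)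
    thus "x - y - (c x - c y) *\<^sub>R v \<in> E" using c(2) that E(1) by (metis subspace_diff)
  qed
  show ?thesis
    unfolding closed_sequential_limits
  proof (intro allI impI)
    fix x l assume x: "(\<forall>n. x n \<in> span (insert v E)) \<and> x \<longlonglongrightarrow> l"
    have "Cauchy (\<lambda>n. c (x n))"
    proof (rule metric_CauchyI)
      fix e :: real assume "e > 0"
      obtain M where M: "\<And>m n. m \<ge> M \<Longrightarrow> n \<ge> M \<Longrightarrow> dist (x m) (x n) < e * \<delta>"
        using metric_CauchyD[OF LIMSEQ_imp_Cauchy, of x l "e * \<delta>"] x c(1) \<open>e > 0\<close> by auto
      have "dist (c (x m)) (c (x n)) < e" if "m \<ge> M" "n \<ge> M" for m n
      proof -
        have "\<bar>c (x m - x n)\<bar> * \<delta> \<le> norm (x m - x n)" using x by (intro c(4) span_diff) auto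
        also have "\<dots> < e * \<delta>" using M[OF that] by (simp add: dist_norm)
        finally show ?thesis using c(1) x diff by (simp add: dist_real_def)
      qed
      thus "\<exists>M. \<forall>m\<ge>M. \<forall>n\<ge>M. dist (c (x m)) (c (x n)) < e" by blast
    qed
    then obtain k where k: "(\<lambda>n. c (x n)) \<longlonglongrightarrow> k" by (auto simp: Cauchy_convergent_iff convergent_def)
    hence lim: "(\<lambda>n. x n - c (x n) *\<^sub>R v) \<longlonglongrightarrow> l - k *\<^sub>R v" using x by (intro tendsto_intros) auto
    have "x n - c (x n) *\<^sub>R v \<in> E" for n using c(2) x by simp
    hence "l - k *\<^sub>R v \<in> E" using lim by (rule closed_sequentially[OF E(2)])
    thus "l \<in> span (insert v E)" using span_insert_decompose[OF E(1)] by blast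
  qed
qed

text \<open>The map \<open>P\<close> is the identity minus a bounded map of finite rank, and such
  maps turn weak convergence into norm convergence. The filter is arbitrary, to cover both
  \<open>sequentially\<close> and ultrafilters.\<close>

lemma fin_codim_projection:
  fixes E :: "'a::banach set"
  assumes "fin_codim_subspace E"
  obtains P where "bounded_linear P" "\<And>x. P x \<in> E"
    "\<And>G d. (\<And>g::'a \<Rightarrow>\<^sub>L real. ((\<lambda>n::nat. blinfun_apply g (d n)) \<longlongrightarrow> 0) G) \<Longrightarrow> ((\<lambda>n. d n - P (d n)) \<longlongrightarrow> 0) G"
proof -
  obtain F where F: "finite F" "subspace E" "closed E" "span (E \<union> F) = UNIV"
    using assms by (auto simp: fin_codim_subspace_def)
  have "\<exists>P. bounded_linear P \<and> (\<forall>x. P x \<in> E) \<and>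
    (\<forall>G d. (\<forall>g::'a \<Rightarrow>\<^sub>L real. ((\<lambda>n::nat. blinfun_apply g (d n)) \<longlongrightarrow> 0) G) \<longrightarrow> ((\<lambda>n. d n - P (d n)) \<longlongrightarrow> 0) G)"
    using F
  proof (induction F arbitrary: E)
    case empty
    hence "E = UNIV" by (metis span_eq_iff Un_empty_right)
    thus ?case by (intro exI[of _ "\<lambda>x. x"]) (auto simp: bounded_linear_ident)
  next
    case (insert v F)
    let ?E' = "span (insert v E)"
    have "E \<union> insert v F \<subseteq> ?E' \<union> F" using span_superset[of "insert v E"] by blast
    hence "span (?E' \<union> F) = UNIV" using insert.prems(3) span_mono by blast
    moreover have "closed ?E'" using insert.prems by (intro closed_span_insert)
    ultimately obtain P where P: "bounded_linear P" "\<And>x. P x \<in> ?E'"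
      "\<And>G d. (\<forall>g::'a \<Rightarrow>\<^sub>L real. ((\<lambda>n::nat. blinfun_apply g (d n)) \<longlongrightarrow> 0) G) \<Longrightarrow> ((\<lambda>n. d n - P (d n)) \<longlongrightarrow> 0) G"
      using insert.IH[of ?E'] by (metis subspace_span)
    show ?case
    proof (cases "v \<in> E")
      case True
      hence "?E' = E" using insert.prems by (metis insert_absorb span_eq_iff)
      thus ?thesis using P by blast
    next
      case False
      obtain \<delta> c where c: "\<delta> > 0" "\<And>x. x \<in> ?E' \<Longrightarrow> x - c x *\<^sub>R v \<in> E"
        "\<And>x k. x - k *\<^sub>R v \<in> E \<Longrightarrow> c x = k" "\<And>x. x \<in> ?E' \<Longrightarrow> \<bar>c x\<bar> * \<delta> \<le> norm x"
        by (rule closed_subspace_insert_coordinate[OF insert.prems(1,2) False]) (rule that)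
      obtain K where K: "\<And>x. norm (P x) \<le> norm x * K" using bounded_linear.bounded[OF P(1)] by blast
      note lin = bounded_linear.linear[OF P(1)]
      \<comment> \<open>The coefficient of \<open>v\<close> in \<open>P x\<close> is a bounded
        functional of \<open>x\<close>, so it tends to 0 along a weakly null \<open>d\<close>;
        removing that multiple of \<open>v\<close> from \<open>P x\<close> lands in
        \<open>E\<close>.\<close>
      have gl: "bounded_linear (\<lambda>x. c (P x))"
      proof (rule bounded_linear_intro[of _ "K / \<delta>"])
        fix x y
        have "P (x + y) - (c (P x) + c (P y)) *\<^sub>R v = (P x - c (P x) *\<^sub>R v) + (P y - c (P y) *\<^sub>R v)"
          by (simp add: linear_add[OF lin] algebra_simps)
        thus "c (P (x + y)) = c (P x) + c (P y)"
          using c(2) P(2) insert.prems(1) by (intro c(3)) (simp add: subspace_add)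
      next
        fix r x
        have "P (r *\<^sub>R x) - (r * c (P x)) *\<^sub>R v = r *\<^sub>R (P x - c (P x) *\<^sub>R v)"
          by (simp add: linear_scale[OF lin] algebra_simps)
        thus "c (P (r *\<^sub>R x)) = r *\<^sub>R c (P x)"
          using c(2) P(2) insert.prems(1) by (intro c(3)) (simp add: subspace_scale)
      next
        fix x
        have "\<bar>c (P x)\<bar> * \<delta> \<le> norm x * K" using c(4)[OF P(2)] K by (rule order_trans)
        thus "norm (c (P x)) \<le> norm x * (K / \<delta>)" using c(1) by (simp add: field_simps)
      qed
      let ?Q = "\<lambda>x. P x - c (P x) *\<^sub>R v"
      have "bounded_linear ?Q"
        using gl by (intro bounded_linear_sub P(1) bounded_linear_compose[OF bounded_linear_scaleR_left gl])
      moreover have "((\<lambda>n. d n - ?Q (d n)) \<longlongrightarrow> 0) G"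
        if d: "\<forall>g::'a \<Rightarrow>\<^sub>L real. ((\<lambda>n::nat. blinfun_apply g (d n)) \<longlongrightarrow> 0) G" for G d
      proof -
        have "((\<lambda>n. c (P (d n))) \<longlongrightarrow> 0) G"
          using d[rule_format, of "Blinfun (\<lambda>x. c (P x))"] gl by (simp add: bounded_linear_Blinfun_apply)
        hence "((\<lambda>n. (d n - P (d n)) + c (P (d n)) *\<^sub>R v) \<longlongrightarrow> 0 + 0 *\<^sub>R v) G"
          using P(3)[OF d] by (intro tendsto_intros)
        thus ?thesis by (simp add: algebra_simps)
      qed
      ultimately show ?thesis using c(2) P(2) by (intro exI[of _ ?Q]) auto
    qed
  qed
  thus ?thesis using that by blast
qed

subsection \<open>Asymptotic uniform smoothness and iterated ultrafilters\<close>

text \<open>The modulus controls only perturbations of norm exactly \<open>t\<close>; convexity of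
  the norm extends the bound to shorter ones.\<close>

lemma asym_smooth_finite_codim:
  assumes "asymptotically_uniformly_smooth_power TYPE('a::real_normed_vector) r"
  obtains C where "C \<ge> 1"
    "\<And>(z::'a) t. norm z = 1 \<Longrightarrow> 0 < t \<Longrightarrow> t \<le> 1 \<Longrightarrow>
       \<exists>E. fin_codim_subspace E \<and> (\<forall>h\<in>E. norm h \<le> t \<longrightarrow> norm (z + h) \<le> 1 + C * t powr r)"
proof -
  obtain C0 where C0: "\<And>t. 0 \<le> t \<Longrightarrow> t \<le> 1 \<Longrightarrow> asym_smooth_modulus TYPE('a) t \<le> ereal (C0 * t powr r)"
    using assms unfolding asymptotically_uniformly_smooth_power_def by (metis atLeastAtMost_iff)
  \<comment> \<open>The extra 1 makes the bound strict, so that some \<open>E\<close> in the infimum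
    stays below it.\<close>
  define C where "C = max C0 0 + 1"
  have "\<exists>E. fin_codim_subspace E \<and> (\<forall>h\<in>E. norm h \<le> t \<longrightarrow> norm (z + h) \<le> 1 + C * t powr r)"
    if z: "norm z = 1" and t: "0 < t" "t \<le> 1" for z :: 'a and t
  proof -
    let ?S = "\<lambda>z E. SUP h\<in>{h\<in>E. norm h = 1}. ereal (norm (z + t *\<^sub>R h))"
    have "(SUP z\<in>{z::'a. norm z = 1}. INF E\<in>{E. fin_codim_subspace E}. ?S z E) \<le> ereal (C0 * t powr r) + 1"
      using C0[of t] t unfolding asym_smooth_modulus_def by (simp add: ereal_minus_le)
    hence "(INF E\<in>{E. fin_codim_subspace E}. ?S z E) \<le> ereal (C0 * t powr r) + 1"
      using z by (auto simp: SUP_le_iff)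
    also have "\<dots> < ereal (1 + C * t powr r)"
      using t by (simp add: one_ereal_def C_def add.commute mult_strict_right_mono)
    finally obtain E where E: "fin_codim_subspace E" "?S z E < ereal (1 + C * t powr r)"
      by (auto simp: INF_less_iff)
    have "norm (z + h) \<le> 1 + C * t powr r" if h: "h \<in> E" "norm h \<le> t" for h
    proof (cases "h = 0")
      case True
      thus ?thesis using z by (simp add: C_def)
    next
      case False
      define u where "u = h /\<^sub>R norm h"
      have u: "u \<in> E" "norm u = 1"
        using E(1) h False by (auto simp: u_def fin_codim_subspace_def subspace_scale)
      have "ereal (norm (z + t *\<^sub>R u)) \<le> ?S z E" using u by (intro SUP_upper) auto
      hence le: "norm (z + t *\<^sub>R u) \<le> 1 + C * t powr r"
        using E(2) by (meson ereal_less_eq(3) less_imp_le order_trans)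
      define a where "a = norm h / t"
      have a: "0 \<le> a" "a \<le> 1" using h t by (auto simp: a_def)
      have "z + h = (1 - a) *\<^sub>R z + a *\<^sub>R (z + t *\<^sub>R u)"
        using False t by (simp add: a_def u_def algebra_simps)
      hence "norm (z + h) \<le> (1 - a) * norm z + a * norm (z + t *\<^sub>R u)"
        using norm_triangle_ineq[of "(1 - a) *\<^sub>R z" "a *\<^sub>R (z + t *\<^sub>R u)"] a by simp
      also have "\<dots> \<le> (1 - a) * (1 + C * t powr r) + a * (1 + C * t powr r)"
        using a le z by (intro add_mono mult_left_mono) (auto simp: C_def)
      finally show ?thesis by (simp add: algebra_simps)
    qed
    thus ?thesis using E(1) by blast
  qed
  thus ?thesis by (intro that[of C]) (auto simp: C_def)
qed

lemma one_plus_powr_le: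
  fixes a x r :: real
  assumes "1 \<le> r" "0 \<le> a" "0 \<le> x" "x \<le> 1"
  shows "(1 + a * x) powr r \<le> 1 + (1 + a) powr r * x"
proof -
  have "((1 - x) *\<^sub>R 1 + x *\<^sub>R (1 + a)) powr r \<le> (1 - x) * 1 powr r + x * (1 + a) powr r"
    using assms by (intro convex_onD[OF powr_convex[OF assms(1)]]) auto
  moreover have "(1 - x) *\<^sub>R 1 + x *\<^sub>R (1 + a) = 1 + a * x" by (simp add: algebra_simps)
  ultimately show ?thesis using assms(3) by (simp add: algebra_simps)
qed

text \<open>The slack \<open>\<eta>\<close> absorbs replacing an almost-element of \<open>E\<close> by an element of \<open>E\<close>.\<close>

lemma asym_smooth_power_step:
  assumes aus: "asymptotically_uniformly_smooth_power TYPE('a::real_normed_vector) r" and r: "1 \<le> r"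
  obtains C where "C > 0"
    "\<And>s::'a. \<exists>E B. fin_codim_subspace E \<and> B powr r \<le> norm s powr r + C \<and>
        (\<exists>\<eta>>0. \<forall>h\<in>E. norm h \<le> 1 \<longrightarrow> norm (s + h) + \<eta> \<le> B)"
proof -
  obtain C where C: "C \<ge> 1"
    "\<And>(z::'a) t. norm z = 1 \<Longrightarrow> 0 < t \<Longrightarrow> t \<le> 1 \<Longrightarrow>
       \<exists>E. fin_codim_subspace E \<and> (\<forall>h\<in>E. norm h \<le> t \<longrightarrow> norm (z + h) \<le> 1 + C * t powr r)"
    using asym_smooth_finite_codim[OF aus] by blast
  define K where "K = 3 powr r + (1 + 2 * C) powr r"
  have "\<exists>E B. fin_codim_subspace E \<and> B powr r \<le> norm s powr r + K \<and>
        (\<exists>\<eta>>0. \<forall>h\<in>E. norm h \<le> 1 \<longrightarrow> norm (s + h) + \<eta> \<le> B)" for s :: 'a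
  proof (cases "norm s < 1")
    case True
    have "fin_codim_subspace (UNIV :: 'a set)"
      by (auto simp: fin_codim_subspace_def intro!: exI[of _ "{}"])
    moreover have "norm (s + h) + 1 \<le> 3" if "norm h \<le> 1" for h
      using True that norm_triangle_ineq[of s h] by linarith
    ultimately show ?thesis
      by (intro exI[of _ UNIV] exI[of _ 3] conjI exI[of _ 1]) (auto simp: K_def)
  next
    case False
    define N where "N = norm s"
    have N: "N \<ge> 1" using False by (simp add: N_def)
    have "norm (s /\<^sub>R N) = 1"
      using N unfolding N_def by (metis norm_eq_zero not_one_le_zero norm_sgn sgn_div_norm)
    then obtain E where E: "fin_codim_subspace E"
      "\<And>h. h \<in> E \<Longrightarrow> norm h \<le> 1 / N \<Longrightarrow> norm (s /\<^sub>R N + h) \<le> 1 + C * (1 / N) powr r"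
      using C(2)[of "s /\<^sub>R N" "1 / N"] N by auto
    \<comment> \<open>Division by \<open>N\<close> turns the unit ball into one of radius
      \<open>1 / N\<close>. The identity \<open>N powr r * x = 1\<close> makes the final increment
      independent of \<open>s\<close>.\<close>
    define x where "x = (1 / N) powr r"
    have x: "0 < x" "x \<le> 1" "N powr r * x = 1"
      using N r by (auto simp: x_def powr_divide ge_one_powr_ge_zero)
    \<comment> \<open>The factor 2 doubles the smoothness increment \<open>C * x\<close>; the spare
      half, \<open>N * C * x\<close>, is the slack.\<close>
    define B where "B = N * (1 + 2 * C * x)"
    have "norm (s + h) + N * C * x \<le> B" if h: "h \<in> E" "norm h \<le> 1" for h
    proof -
      have "h /\<^sub>R N \<in> E" using h E(1) by (simp add: fin_codim_subspace_def subspace_scale)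
      moreover have "norm (h /\<^sub>R N) \<le> 1 / N" using h N by (simp add: field_simps)
      ultimately have "norm (s /\<^sub>R N + h /\<^sub>R N) \<le> 1 + C * x" unfolding x_def by (rule E(2))
      hence "N * norm (s /\<^sub>R N + h /\<^sub>R N) \<le> N * (1 + C * x)" using N by simp
      moreover have "norm (s + h) = N * norm (s /\<^sub>R N + h /\<^sub>R N)"
        using N by (simp add: scaleR_right_distrib[symmetric])
      ultimately show ?thesis by (simp add: B_def algebra_simps)
    qed
    moreover have "B powr r \<le> norm s powr r + K"
    proof -
      have "B powr r = N powr r * (1 + 2 * C * x) powr r"
        using N x C by (simp add: B_def powr_mult)
      also have "\<dots> \<le> N powr r * (1 + (1 + 2 * C) powr r * x)"
        using x C r by (intro mult_left_mono one_plus_powr_le) auto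
      also have "\<dots> = N powr r + (1 + 2 * C) powr r" using x(3) by (simp add: algebra_simps)
      also have "\<dots> \<le> N powr r + K" by (simp add: K_def)
      finally show ?thesis by (simp add: N_def)
    qed
    moreover have "0 < N * C * x" using N C x by simp
    ultimately show ?thesis using E(1) by blast
  qed
  moreover have "K > 0" using C by (simp add: K_def add_pos_nonneg)
  ultimately show ?thesis using that by blast
qed

text \<open>The vector \<open>d n\<close> approaches \<open>P (d n)\<close>, which lies in
  \<open>E\<close> but may be slightly longer than 1. Half of \<open>\<eta>\<close> pays for the
  approximation and half for shrinking \<open>P (d n)\<close> into the unit ball.\<close>

lemma weakly_null_near_fin_codim:
  fixes d :: "nat \<Rightarrow> 'a::banach"
  assumes E: "fin_codim_subspace E" and "\<eta> > 0" and B: "\<And>h. h \<in> E \<Longrightarrow> norm h \<le> 1 \<Longrightarrow> norm (s + h) + \<eta> \<le> B"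
    and wn: "\<And>g::'a \<Rightarrow>\<^sub>L real. ((\<lambda>n. blinfun_apply g (d n)) \<longlongrightarrow> 0) F" and d: "\<And>n. norm (d n) \<le> 1"
  shows "\<forall>\<^sub>F n in F. norm (s + d n) \<le> B"
proof -
  obtain P where P: "\<And>x. P x \<in> E" "((\<lambda>n. d n - P (d n)) \<longlongrightarrow> 0) F"
    using fin_codim_projection[OF E] wn by metis
  define \<epsilon> where "\<epsilon> = \<eta> / 2"
  have \<epsilon>: "\<epsilon> > 0" using \<open>\<eta> > 0\<close> by (simp add: \<epsilon>_def)
  have "\<forall>\<^sub>F n in F. norm (d n - P (d n)) < \<epsilon>"
    using tendstoD[OF P(2) \<epsilon>] by (simp add: dist_norm)
  thus ?thesis
  proof eventually_elim
    case (elim n)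
    let ?p = "P (d n)"
    have p: "norm ?p \<le> 1 + \<epsilon>"
      using norm_triangle_ineq2[of ?p "d n"] elim d[of n] by (simp add: norm_minus_commute)
    define h where "h = (1 / (1 + \<epsilon>)) *\<^sub>R ?p"
    have h: "h \<in> E" using P(1) E by (simp add: h_def fin_codim_subspace_def subspace_scale)
    have "norm h \<le> 1" using p \<epsilon> by (simp add: h_def)
    hence 1: "norm (s + h) + \<eta> \<le> B" using B h by blast
    have "?p - h = \<epsilon> *\<^sub>R h" 
    proof -
      have "?p = (1 + \<epsilon>) *\<^sub>R h" using \<epsilon> by (simp add: h_def)
      thus ?thesis by (simp add: algebra_simps)
    qed
    hence "norm (?p - h) \<le> \<epsilon>" using \<epsilon> \<open>norm h \<le> 1\<close> by (simp add: mult_le_cancel_left1)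
    moreover have "norm (s + d n) \<le> norm (s + h) + norm (?p - h) + norm (d n - ?p)"
    proof -
      have "s + d n = (s + h) + (?p - h) + (d n - ?p)" by simp
      thus ?thesis using norm_triangle_ineq[of "(s + h) + (?p - h)" "d n - ?p"] norm_triangle_ineq[of "s + h" "?p - h"]
        by simp
    qed
    ultimately show ?case using 1 elim by (simp add: \<epsilon>_def)
  qed
qed

text \<open>The \<open>k\<close>-fold Fubini power of \<open>F\<close>, living on lists of length
  \<open>k\<close>. The head is chosen first, so the large set of admissible values of a later entry
  may depend on the earlier ones.\<close>

primrec iter_ev :: "nat filter \<Rightarrow> nat \<Rightarrow> (nat list \<Rightarrow> bool) \<Rightarrow> bool" where
  "iter_ev F 0 P = P []"
| "iter_ev F (Suc k) P = (\<forall>\<^sub>F n in F. iter_ev F k (\<lambda>l. P (n # l)))"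

lemma iter_ev_mono:
  "iter_ev F k P \<Longrightarrow> (\<And>l. length l = k \<Longrightarrow> P l \<Longrightarrow> Q l) \<Longrightarrow> iter_ev F k Q"
proof (induction k arbitrary: P Q)
  case (Suc k)
  from Suc.prems(1) have "\<forall>\<^sub>F n in F. iter_ev F k (\<lambda>l. P (n # l))" by simp
  hence "\<forall>\<^sub>F n in F. iter_ev F k (\<lambda>l. Q (n # l))"
    by (rule eventually_mono) (erule Suc.IH, simp add: Suc.prems(2))
  thus ?case by simp
qed simp

lemma iter_ev_conj: "iter_ev F k P \<Longrightarrow> iter_ev F k Q \<Longrightarrow> iter_ev F k (\<lambda>l. P l \<and> Q l)"
proof (induction k arbitrary: P Q)
  case (Suc k)
  have "\<forall>\<^sub>F n in F. iter_ev F k (\<lambda>l. P (n # l)) \<and> iter_ev F k (\<lambda>l. Q (n # l))"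
    using Suc.prems by (simp add: eventually_conj)
  hence "\<forall>\<^sub>F n in F. iter_ev F k (\<lambda>l. P (n # l) \<and> Q (n # l))"
    by (rule eventually_mono) (simp add: Suc.IH)
  thus ?case by simp
qed simp

lemma iter_ev_ex: "F \<noteq> bot \<Longrightarrow> iter_ev F k P \<Longrightarrow> \<exists>l. length l = k \<and> P l"
proof (induction k arbitrary: P)
  case (Suc k)
  then obtain n where "iter_ev F k (\<lambda>l. P (n # l))" by (auto dest: eventually_happens)
  then obtain l where "length l = k" "P (n # l)" using Suc by blast
  thus ?case by (intro exI[of _ "n # l"]) simp
qed simp

lemma iter_ev_ultra:
  assumes "free_ultrafilter F"
  shows "iter_ev F k P \<or> iter_ev F k (\<lambda>l. \<not> P l)"
proof (induction k arbitrary: P)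
  case (Suc k)
  have "(\<forall>\<^sub>F n in F. iter_ev F k (\<lambda>l. P (n # l))) \<or> (\<forall>\<^sub>F n in F. \<not> iter_ev F k (\<lambda>l. P (n # l)))"
    using assms by (auto simp: free_ultrafilter_def)
  thus ?case
  proof
    assume "\<forall>\<^sub>F n in F. \<not> iter_ev F k (\<lambda>l. P (n # l))"
    hence "\<forall>\<^sub>F n in F. iter_ev F k (\<lambda>l. \<not> P (n # l))"
    proof (rule eventually_mono)
      fix n assume "\<not> iter_ev F k (\<lambda>l. P (n # l))"
      thus "iter_ev F k (\<lambda>l. \<not> P (n # l))" using Suc[of "\<lambda>l. P (n # l)"] by blast
    qed
    thus ?thesis by simp
  qed simp
qed simp

text \<open>Pigeonhole for the iterated ultrafilter: a piece that is not generic has a generic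
  complement, which the remaining pieces still cover.\<close>

lemma iter_ev_finite_cover:
  assumes F: "free_ultrafilter F" and "finite A" "iter_ev F k (\<lambda>l. \<exists>a\<in>A. P a l)"
  shows "\<exists>a\<in>A. iter_ev F k (P a)"
  using assms(2,3)
proof (induction A)
  case empty
  thus ?case using iter_ev_ex[of F k "\<lambda>l. False"] F by (auto simp: free_ultrafilter_def)
next
  case (insert a A)
  show ?case
  proof (cases "iter_ev F k (P a)")
    case False
    hence "iter_ev F k (\<lambda>l. \<not> P a l)" using iter_ev_ultra[OF F] by blast
    from iter_ev_conj[OF this insert.prems] have "iter_ev F k (\<lambda>l. \<exists>a\<in>A. P a l)"
      by (rule iter_ev_mono) auto
    thus ?thesis using insert.IH by blast
  qed blast
qed

lemma iter_ev_distinct_ge: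
  assumes "F \<le> sequentially"
  shows "iter_ev F k (\<lambda>l. distinct l \<and> (\<forall>j\<in>set l. m \<le> j))"
proof (induction k arbitrary: m)
  case (Suc k)
  have "\<forall>\<^sub>F n in F. m \<le> n" using assms by (rule filter_leD) (rule eventually_ge_at_top)
  hence "\<forall>\<^sub>F n in F. iter_ev F k (\<lambda>l. distinct (n # l) \<and> (\<forall>j\<in>set (n # l). m \<le> j))"
  proof eventually_elim
    case (elim n)
    \<comment> \<open>The bound \<open>Suc n\<close> makes all later entries exceed
      \<open>n\<close>, which yields distinctness.\<close>
    show ?case using Suc.IH[of "max m (Suc n)"]
      by (rule iter_ev_mono) (use elim in auto)
  qed
  thus ?case by simp
qed simp

lemma iter_ev_functional_small:
  assumes "((\<lambda>n. blinfun_apply g (x n)) \<longlongrightarrow> (0::real)) F" "\<epsilon> > 0"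
  shows "iter_ev F k (\<lambda>l. \<bar>blinfun_apply g (sum_list (map x l))\<bar> < \<epsilon>)"
  using assms(2)
proof (induction k arbitrary: \<epsilon>)
  case 0
  thus ?case by (simp add: blinfun.zero_right)
next
  case (Suc k)
  have "\<forall>\<^sub>F n in F. \<bar>blinfun_apply g (x n)\<bar> < \<epsilon> / 2"
    using tendstoD[OF assms(1), of "\<epsilon> / 2"] Suc.prems by simp
  hence "\<forall>\<^sub>F n in F. iter_ev F k (\<lambda>l. \<bar>blinfun_apply g (sum_list (map x (n # l)))\<bar> < \<epsilon>)"
  proof eventually_elim
    case (elim n)
    have "\<epsilon> / 2 > 0" using Suc.prems by simp
    from Suc.IH[OF this] show ?case
      by (rule iter_ev_mono) (use elim in \<open>auto simp: blinfun.add_right\<close>)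
  qed
  thus ?case by simp
qed

text \<open>Here \<open>s\<close> stands for the partial sum chosen so far; keeping it arbitrary
  lets the induction absorb each new vector into it.\<close>

lemma iter_ev_upper_estimate:
  fixes x :: "nat \<Rightarrow> 'a::real_normed_vector"
  assumes step: "\<And>s::'a. \<forall>\<^sub>F n in F. norm (s + x n) powr r \<le> norm s powr r + C"
  shows "iter_ev F k (\<lambda>l. norm (s + sum_list (map x l)) powr r \<le> norm s powr r + real k * C)"
proof (induction k arbitrary: s)
  case (Suc k)
  have "\<forall>\<^sub>F n in F. iter_ev F k (\<lambda>l. norm (s + sum_list (map x (n # l))) powr r \<le> norm s powr r + real (Suc k) * C)"
    using step[of s]
  proof eventually_elim
    case (elim n)
    show ?case using Suc.IH[of "s + x n"]
      by (rule iter_ev_mono) (use elim in \<open>auto simp: algebra_simps\<close>)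
  qed
  thus ?case by simp
qed simp

subsection \<open>Concentration and weakly null sequences\<close>

text \<open>The limits of \<open>g (y n)\<close> along the ultrafilter, taken over all
  \<open>g\<close>, form an element of the bidual, which reflexivity represents by a point.\<close>

lemma reflexive_weak_limit:
  fixes y :: "nat \<Rightarrow> 'a::real_normed_vector"
  assumes "reflexive TYPE('a)" and F: "free_ultrafilter F" and bound: "\<And>n. norm (y n) \<le> B"
  obtains l where "\<And>g::'a \<Rightarrow>\<^sub>L real. ((\<lambda>n. blinfun_apply g (y n)) \<longlongrightarrow> blinfun_apply g l) F"
proof -
  have F0: "F \<noteq> bot" using F by (simp add: free_ultrafilter_def)
  have b: "\<bar>blinfun_apply g (y n)\<bar> \<le> norm g * B" for g :: "'a \<Rightarrow>\<^sub>L real" and n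
    using norm_blinfun[of g "y n"] mult_left_mono[OF bound[of n] norm_ge_zero[of g]] by simp
  have "\<exists>l. ((\<lambda>n. blinfun_apply g (y n)) \<longlongrightarrow> l) F" for g :: "'a \<Rightarrow>\<^sub>L real"
    using b by (intro ultrafilter_limit[OF F])
  then obtain \<phi> where \<phi>: "\<And>g::'a \<Rightarrow>\<^sub>L real. ((\<lambda>n. blinfun_apply g (y n)) \<longlongrightarrow> \<phi> g) F" by metis
  have "bounded_linear \<phi>"
  proof (rule bounded_linear_intro[of _ B])
    fix g h :: "'a \<Rightarrow>\<^sub>L real"
    have "((\<lambda>n. blinfun_apply (g + h) (y n)) \<longlongrightarrow> \<phi> g + \<phi> h) F"
      using tendsto_add[OF \<phi>[of g] \<phi>[of h]] by (simp add: blinfun.add_left)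
    thus "\<phi> (g + h) = \<phi> g + \<phi> h" by (rule tendsto_unique[OF F0 \<phi>])
  next
    fix r and g :: "'a \<Rightarrow>\<^sub>L real"
    have "((\<lambda>n. blinfun_apply (r *\<^sub>R g) (y n)) \<longlongrightarrow> r *\<^sub>R \<phi> g) F"
      using tendsto_scaleR[OF tendsto_const \<phi>[of g], of r] by (simp add: blinfun.scaleR_left)
    thus "\<phi> (r *\<^sub>R g) = r *\<^sub>R \<phi> g" by (rule tendsto_unique[OF F0 \<phi>])
  next
    fix g :: "'a \<Rightarrow>\<^sub>L real"
    have "((\<lambda>n. \<bar>blinfun_apply g (y n)\<bar>) \<longlongrightarrow> \<bar>\<phi> g\<bar>) F" using \<phi>[of g] by (rule tendsto_rabs)
    hence "\<bar>\<phi> g\<bar> \<le> norm g * B" using b[of g] F0 by (intro tendsto_upperbound[of _ _ F]) (auto intro!: eventuallyI)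
    thus "norm (\<phi> g) \<le> norm g * B" by simp
  qed
  then obtain l where "\<And>g. \<phi> g = blinfun_apply g l"
    using assms(1) unfolding reflexive_def by (metis bounded_linear_Blinfun_apply)
  thus ?thesis using \<phi> by (intro that[of l]) simp
qed

text \<open>The Kalton--Randrianarivony concentration inequality. In place of an infinite subset of the
  naturals on which the map concentrates, it is phrased with the \<open>k\<close>-fold iterate of an ultrafilter;
  the successive weak limits along the ultrafilter split \<open>G\<close> into martingale-like differences.\<close>

lemma reflexive_concentration:
  fixes G :: "nat list \<Rightarrow> 'a::real_normed_vector"
  assumes refl: "reflexive TYPE('a)" and F: "free_ultrafilter F"
    and step: "\<And>(s::'a) d. (\<And>g::'a \<Rightarrow>\<^sub>L real. ((\<lambda>n. blinfun_apply g (d n)) \<longlongrightarrow> 0) F) \<Longrightarrow>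
        (\<And>n. norm (d n) \<le> 1) \<Longrightarrow> \<forall>\<^sub>F n in F. norm (s + d n) powr r \<le> norm s powr r + C"
    and lip: "\<And>xs n m ys. length xs + length ys + 1 = k \<Longrightarrow> norm (G (xs @ n # ys) - G (xs @ m # ys)) \<le> 1"
  shows "\<exists>y. (\<forall>(g::'a \<Rightarrow>\<^sub>L real) \<epsilon>. \<epsilon> > 0 \<longrightarrow> iter_ev F k (\<lambda>l. \<bar>blinfun_apply g (G l) - blinfun_apply g y\<bar> < \<epsilon>)) \<and>
      (\<forall>s. iter_ev F k (\<lambda>l. norm (s + (G l - y)) powr r \<le> norm s powr r + real k * C))"
  using lip
proof (induction k arbitrary: G)
  case 0
  show ?case by (intro exI[of _ "G []"]) simp
next
  case (Suc k)
  have F0: "F \<noteq> bot" using F by (simp add: free_ultrafilter_def)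
  \<comment> \<open>With the first index \<open>n\<close> frozen, the remaining function of
    \<open>k\<close> indices has a generic value, called \<open>y n\<close> below.\<close>
  have "\<exists>y. (\<forall>(g::'a \<Rightarrow>\<^sub>L real) \<epsilon>. \<epsilon> > 0 \<longrightarrow> iter_ev F k (\<lambda>l. \<bar>blinfun_apply g (G (n # l)) - blinfun_apply g y\<bar> < \<epsilon>)) \<and>
      (\<forall>s. iter_ev F k (\<lambda>l. norm (s + (G (n # l) - y)) powr r \<le> norm s powr r + real k * C))" for n
  proof (rule Suc.IH[of "\<lambda>l. G (n # l)"])
    fix xs ys :: "nat list" and i j assume "length xs + length ys + 1 = k"
    thus "norm (G (n # xs @ i # ys) - G (n # xs @ j # ys)) \<le> 1"
      using Suc.prems[of "n # xs" ys i j] by simp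
  qed
  then obtain y where y1: "\<And>n (g::'a \<Rightarrow>\<^sub>L real) \<epsilon>. \<epsilon> > 0 \<Longrightarrow> iter_ev F k (\<lambda>l. \<bar>blinfun_apply g (G (n # l)) - blinfun_apply g (y n)\<bar> < \<epsilon>)"
    and y2: "\<And>n s. iter_ev F k (\<lambda>l. norm (s + (G (n # l) - y n)) powr r \<le> norm s powr r + real k * C)"
    by metis
  \<comment> \<open>The lists \<open>n # l\<close> and \<open>m # l\<close> with a common generic
    tail differ in one entry; a functional norming \<open>y n - y m\<close> compares them. The weak
    clause of the conclusion is carried through the induction for this comparison.\<close>
  have ylip: "norm (y n - y m) \<le> 1" for n m
  proof (rule field_le_epsilon)
    fix \<epsilon> :: real assume "\<epsilon> > 0"
    obtain g :: "'a \<Rightarrow>\<^sub>L real" where g: "\<And>z. \<bar>blinfun_apply g z\<bar> \<le> norm z" "blinfun_apply g (y n - y m) = norm (y n - y m)"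
      using norming_functional by blast
    have \<epsilon>2: "\<epsilon> / 2 > 0" using \<open>\<epsilon> > 0\<close> by simp
    obtain l where l: "length l = k" "\<bar>blinfun_apply g (G (n # l)) - blinfun_apply g (y n)\<bar> < \<epsilon> / 2"
      "\<bar>blinfun_apply g (G (m # l)) - blinfun_apply g (y m)\<bar> < \<epsilon> / 2"
      using iter_ev_ex[OF F0 iter_ev_conj[OF y1[OF \<epsilon>2, of g n] y1[OF \<epsilon>2, of g m]]] by blast
    have "blinfun_apply g (G (n # l)) - blinfun_apply g (G (m # l)) \<le> 1"
      using g(1)[of "G (n # l) - G (m # l)"] Suc.prems[of "[]" l n m] l(1) by (simp add: blinfun.diff_right)
    thus "norm (y n - y m) \<le> 1 + \<epsilon>" using g(2) l(2,3) unfolding blinfun.diff_right by linarith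
  qed
  have "norm (y n) \<le> norm (y 0) + 1" for n using ylip[of n 0] norm_triangle_ineq2[of "y n" "y 0"] by linarith
  then obtain y0 where y0: "\<And>g::'a \<Rightarrow>\<^sub>L real. ((\<lambda>n. blinfun_apply g (y n)) \<longlongrightarrow> blinfun_apply g y0) F"
    using reflexive_weak_limit[OF refl F] by blast
  have ny: "norm (y n - y0) \<le> 1" for n
  proof -
    obtain g :: "'a \<Rightarrow>\<^sub>L real" where g: "\<And>z. \<bar>blinfun_apply g z\<bar> \<le> norm z" "blinfun_apply g (y n - y0) = norm (y n - y0)"
      using norming_functional by blast
    have "((\<lambda>m. blinfun_apply g (y n) - blinfun_apply g (y m)) \<longlongrightarrow> blinfun_apply g (y n) - blinfun_apply g y0) F"
      by (intro tendsto_diff tendsto_const y0)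
    moreover have "blinfun_apply g (y n) - blinfun_apply g (y m) \<le> 1" for m
      using g(1)[of "y n - y m"] ylip[of n m] by (simp add: blinfun.diff_right)
    ultimately have "blinfun_apply g (y n) - blinfun_apply g y0 \<le> 1"
      using F0 by (intro tendsto_upperbound[of _ _ F]) (auto intro!: eventuallyI)
    thus ?thesis using g(2) by (simp add: blinfun.diff_right)
  qed
  \<comment> \<open>The first difference \<open>y n - y0\<close> costs one \<open>C\<close>; the
    induction hypothesis, started at \<open>s + (y n - y0)\<close>, accounts for the other
    \<open>k\<close>.\<close>
  have ev: "\<forall>\<^sub>F n in F. norm (s + (y n - y0)) powr r \<le> norm s powr r + C" for s
  proof (rule step)
    fix g :: "'a \<Rightarrow>\<^sub>L real"
    show "((\<lambda>n. blinfun_apply g (y n - y0)) \<longlongrightarrow> 0) F"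
      using tendsto_diff[OF y0[of g] tendsto_const[of "blinfun_apply g y0"]] by (simp add: blinfun.diff_right)
  qed (rule ny)
  have "\<forall>\<^sub>F n in F. iter_ev F k (\<lambda>l. norm (s + (G (n # l) - y0)) powr r \<le> norm s powr r + real (Suc k) * C)" for s
    using ev[of s]
  proof eventually_elim
    case (elim n)
    show ?case using y2[of "s + (y n - y0)" n]
      by (rule iter_ev_mono) (use elim in \<open>simp add: algebra_simps\<close>)
  qed
  moreover have "\<forall>\<^sub>F n in F. iter_ev F k (\<lambda>l. \<bar>blinfun_apply g (G (n # l)) - blinfun_apply g y0\<bar> < \<epsilon>)"
    if "\<epsilon> > 0" for g :: "'a \<Rightarrow>\<^sub>L real" and \<epsilon>
  proof -
    have \<epsilon>2: "\<epsilon> / 2 > 0" using that by simp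
    have "\<forall>\<^sub>F n in F. \<bar>blinfun_apply g (y n) - blinfun_apply g y0\<bar> < \<epsilon> / 2"
      using tendstoD[OF y0[of g] \<epsilon>2] by (simp add: dist_real_def)
    thus ?thesis
    proof eventually_elim
      case (elim n)
      show ?case using y1[OF \<epsilon>2, of g n]
        by (rule iter_ev_mono) (use elim in linarith)
    qed
  qed
  ultimately show ?case by (intro exI[of _ y0]) simp
qed

section \<open>Existence of normalized weakly null sequences\<close>

lemma powr_less_linear:
  fixes p :: real
  assumes "p > 1" "\<delta> > 0"
  obtains k :: nat where "k > 0" "(real k * C) powr (1 / p) < \<delta> * real k"
proof -
  have "((\<lambda>k. (real k * C) powr (1 / p) / real k) \<longlongrightarrow> 0) sequentially"
  proof -
    have "((\<lambda>k. real k powr (1 / p - 1) * C powr (1 / p)) \<longlongrightarrow> 0 * C powr (1 / p)) sequentially"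
      using assms by (intro tendsto_mult tendsto_const tendsto_neg_powr filterlim_real_sequentially) (simp add: field_simps)
    moreover have "\<forall>\<^sub>F k in sequentially. real k powr (1 / p - 1) * C powr (1 / p) = (real k * C) powr (1 / p) / real k"
      using eventually_gt_at_top[of 0]
    proof eventually_elim
      case (elim k)
      thus ?case by (simp add: powr_diff powr_mult)
    qed
    ultimately show ?thesis by (simp add: tendsto_cong)
  qed
  hence "\<forall>\<^sub>F k in sequentially. k > 0 \<and> (real k * C) powr (1 / p) / real k < \<delta>"
    using assms by (intro eventually_conj eventually_gt_at_top order_tendstoD(2)[where a = \<delta>])
  then obtain k where "k > 0 \<and> (real k * C) powr (1 / p) / real k < \<delta>"
    by (auto dest: eventually_happens)
  thus ?thesis by (intro that[of k]) (auto simp: field_simps)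
qed

text \<open>If a functional were at least \<open>\<delta>\<close> on infinitely many terms, sums of
  \<open>k\<close> of them would have norm of order at least \<open>k\<close>, against an upper
  bound of order \<open>k powr (1 / p)\<close>.\<close>

lemma upper_estimate_imp_weakly_null:
  fixes x :: "nat \<Rightarrow> 'a::real_normed_vector"
  assumes p: "p > 1" and up: "\<And>A. finite A \<Longrightarrow> norm (\<Sum>n\<in>A. x n) powr p \<le> real (card A) * C"
  shows "weakly_null x"
  unfolding weakly_null_def
proof
  fix g :: "'a \<Rightarrow>\<^sub>L real"
  have one: "finite {n. \<delta> \<le> blinfun_apply h (x n)}" if \<delta>: "\<delta> > 0" for h :: "'a \<Rightarrow>\<^sub>L real" and \<delta>
  proof (rule ccontr)
    assume inf: "infinite {n. \<delta> \<le> blinfun_apply h (x n)}"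
    have "\<delta> / (norm h + 1) > 0" using \<delta> by (simp add: add_nonneg_pos)
    then obtain k :: nat where k: "k > 0" "(real k * C) powr (1 / p) < \<delta> / (norm h + 1) * real k"
      by (rule powr_less_linear[OF p])
    obtain A where A: "finite A" "card A = k" "A \<subseteq> {n. \<delta> \<le> blinfun_apply h (x n)}"
      using infinite_arbitrarily_large[OF inf] by blast
    have "norm (\<Sum>n\<in>A. x n) = (norm (\<Sum>n\<in>A. x n) powr p) powr (1 / p)" using p by (simp add: powr_powr)
    also have "\<dots> \<le> (real k * C) powr (1 / p)" using up[OF A(1)] A(2) p by (intro powr_mono2) auto
    finally have le: "norm (\<Sum>n\<in>A. x n) \<le> (real k * C) powr (1 / p)" .
    have "real k * \<delta> = (\<Sum>n\<in>A. \<delta>)" using A by simp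
    also have "\<dots> \<le> (\<Sum>n\<in>A. blinfun_apply h (x n))" using A(3) by (intro sum_mono) auto
    also have "\<dots> = blinfun_apply h (\<Sum>n\<in>A. x n)" by (simp add: blinfun.sum_right)
    also have "\<dots> \<le> norm h * norm (\<Sum>n\<in>A. x n)" using norm_blinfun[of h "\<Sum>n\<in>A. x n"] by simp
    also have "\<dots> \<le> (norm h + 1) * (real k * C) powr (1 / p)" using le by (intro mult_mono) auto
    also have "\<dots> < (norm h + 1) * (\<delta> / (norm h + 1) * real k)"
      using k(2) by (intro mult_strict_left_mono) (auto simp: add_nonneg_pos)
    also have "\<dots> = real k * \<delta>" using norm_ge_zero[of h] by (simp add: field_simps add_nonneg_eq_0_iff)
    finally show False by simp
  qed
  show "(\<lambda>n. blinfun_apply g (x n)) \<longlonglongrightarrow> 0"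
  proof (rule tendstoI)
    fix \<delta> :: real assume \<delta>: "\<delta> > 0"
    have "finite ({n. \<delta> \<le> blinfun_apply g (x n)} \<union> {n. \<delta> \<le> blinfun_apply (- g) (x n)})"
      using one[OF \<delta>] by blast
    moreover have "{n. \<not> dist (blinfun_apply g (x n)) 0 < \<delta>} \<subseteq> {n. \<delta> \<le> blinfun_apply g (x n)} \<union> {n. \<delta> \<le> blinfun_apply (- g) (x n)}"
      by (auto simp: uminus_blinfun.rep_eq dist_real_def)
    ultimately have "finite {n. \<not> dist (blinfun_apply g (x n)) 0 < \<delta>}" by (rule finite_subset[rotated])
    thus "\<forall>\<^sub>F n in sequentially. dist (blinfun_apply g (x n)) 0 < \<delta>"
      by (simp add: eventually_cofinite flip: cofinite_eq_sequentially)
  qed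
qed

text \<open>Each new unit vector is taken from the subspaces \<open>E s\<close> of all subset sums
  \<open>s\<close> of its predecessors, so that adding it to any such sum raises the
  \<open>p\<close>-th power of the norm by at most \<open>C\<close>.\<close>

lemma normalized_weakly_null_exists:
  assumes inf: "infinite_dimensional TYPE('a::real_normed_vector)"
    and aus: "asymptotically_uniformly_smooth_power TYPE('a::real_normed_vector) p" and p: "p > 1"
  obtains x :: "nat \<Rightarrow> 'a::real_normed_vector" where "\<And>n. norm (x n) = 1" "weakly_null x"
proof -
  obtain C where C: "C > 0"
    "\<And>s::'a. \<exists>E B. fin_codim_subspace E \<and> B powr p \<le> norm s powr p + C \<and>
        (\<exists>\<eta>>0. \<forall>h\<in>E. norm h \<le> 1 \<longrightarrow> norm (s + h) + \<eta> \<le> B)"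
    using asym_smooth_power_step[OF aus] p by (metis less_imp_le)
  have "\<exists>E. fin_codim_subspace E \<and> (\<forall>h\<in>E. norm h \<le> 1 \<longrightarrow> norm (s + h) powr p \<le> norm s powr p + C)" for s :: 'a
  proof -
    obtain E B \<eta> where E: "fin_codim_subspace E" "B powr p \<le> norm s powr p + C" "\<eta> > 0"
      "\<And>h. h \<in> E \<Longrightarrow> norm h \<le> 1 \<Longrightarrow> norm (s + h) + \<eta> \<le> B" using C(2)[of s] by blast
    have "norm (s + h) powr p \<le> norm s powr p + C" if "h \<in> E" "norm h \<le> 1" for h
      using powr_mono2[of p "norm (s + h)" B] E(4)[OF that] E(2,3) p by simp
    thus ?thesis using E(1) by blast
  qed
  then obtain E where E: "\<And>s::'a. fin_codim_subspace (E s)"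
    "\<And>s h. h \<in> E s \<Longrightarrow> norm h \<le> 1 \<Longrightarrow> norm (s + h) powr p \<le> norm s powr p + C" by metis
  have next_ex: "\<exists>v. norm v = 1 \<and> (\<forall>s\<in>S. v \<in> E s)" if "finite S" for S
  proof (rule fin_codim_Inter_unit_vector[OF inf, of "E ` S"])
    show "finite (E ` S)" using that by simp
    show "fin_codim_subspace A" if "A \<in> E ` S" for A using that E(1) by auto
    show "\<exists>v. norm v = 1 \<and> (\<forall>s\<in>S. v \<in> E s)" if "norm v = 1" "\<And>A. A \<in> E ` S \<Longrightarrow> v \<in> A" for v
      using that by blast
  qed
  define subsums where "subsums xs = (\<lambda>A. \<Sum>i\<in>A. xs ! i) ` Pow {..<length xs}" for xs :: "'a list"
  define nxt where "nxt xs = (SOME v. norm v = 1 \<and> (\<forall>s\<in>subsums xs. v \<in> E s))" for xs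
  have "finite (subsums xs)" for xs by (simp add: subsums_def)
  hence nxt: "norm (nxt xs) = 1 \<and> (\<forall>s\<in>subsums xs. nxt xs \<in> E s)" for xs
    unfolding nxt_def by (intro someI_ex[OF next_ex])
  define L where "L n = rec_nat [] (\<lambda>_ xs. xs @ [nxt xs]) n" for n
  have L: "L 0 = []" "L (Suc n) = L n @ [nxt (L n)]" for n by (simp_all add: L_def)
  have len: "length (L n) = n" for n by (induction n) (simp_all add: L)
  define x where "x n = nxt (L n)" for n
  have nth: "i < n \<Longrightarrow> L n ! i = x i" for i n
    by (induction n) (auto simp: L len nth_append x_def less_Suc_eq)
  have mem: "x n \<in> E (\<Sum>i\<in>A. x i)" if "A \<subseteq> {..<n}" for A n
  proof -
    have "(\<Sum>i\<in>A. x i) = (\<Sum>i\<in>A. L n ! i)" using that by (intro sum.cong) (auto simp: nth)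
    hence "(\<Sum>i\<in>A. x i) \<in> subsums (L n)" using that unfolding subsums_def len by blast
    thus ?thesis using nxt[of "L n"] by (simp add: x_def)
  qed
  have one: "norm (x n) = 1" for n using nxt by (simp add: x_def)
  have "A \<subseteq> {..<n} \<Longrightarrow> norm (\<Sum>i\<in>A. x i) powr p \<le> real (card A) * C" for A n
  proof (induction n arbitrary: A)
    case (Suc n)
    show ?case
    proof (cases "n \<in> A")
      case True
      let ?A = "A - {n}"
      have sub: "?A \<subseteq> {..<n}" using Suc.prems by (auto simp: less_Suc_eq)
      have fin: "finite A" using Suc.prems finite_subset by blast
      have "(\<Sum>i\<in>A. x i) = (\<Sum>i\<in>?A. x i) + x n" using True fin by (simp add: sum.remove add.commute)
      hence "norm (\<Sum>i\<in>A. x i) powr p \<le> norm (\<Sum>i\<in>?A. x i) powr p + C"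
        using E(2)[OF mem[OF sub]] one[of n] by simp
      also have "\<dots> \<le> real (card ?A) * C + C" using Suc.IH[OF sub] by simp
      also have "\<dots> = real (card A) * C"
        using card_Suc_Diff1[OF fin True] by (simp add: algebra_simps flip: of_nat_Suc)
          (metis add.commute distrib_left mult.right_neutral of_nat_Suc)
      finally show ?thesis .
    next
      case False
      hence "A \<subseteq> {..<n}" using Suc.prems by (auto simp: less_Suc_eq)
      thus ?thesis by (rule Suc.IH)
    qed
  qed simp
  hence "norm (\<Sum>i\<in>A. x i) powr p \<le> real (card A) * C" if "finite A" for A
    using that finite_nat_iff_bounded by blast
  hence "weakly_null x" using p by (intro upper_estimate_imp_weakly_null)
  thus ?thesis using one that by blast
qed

subsection \<open>Approximate midpoints in the target\<close>

lemma basis_coeffs_unique: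
  assumes "schauder_basis e" "(\<lambda>n. \<Sum>i<n. a i *\<^sub>R e i) \<longlonglongrightarrow> y"
  shows "basis_coeffs e y = a"
  unfolding basis_coeffs_def
  by (rule the1_equality) (use assms in \<open>simp_all add: schauder_basis_def\<close>)

lemma basis_coeffs_limit:
  assumes "schauder_basis e"
  shows "(\<lambda>n. \<Sum>i<n. basis_coeffs e y i *\<^sub>R e i) \<longlonglongrightarrow> y"
  unfolding basis_coeffs_def
  by (rule theI'[where P = "\<lambda>a. (\<lambda>n. \<Sum>i<n. a i *\<^sub>R e i) \<longlonglongrightarrow> y"]) (use assms in \<open>simp add: schauder_basis_def\<close>)

lemma basis_support_sum:
  assumes e: "schauder_basis e"
  shows "basis_support e (\<Sum>i<N. a i *\<^sub>R e i) \<subseteq> {..<N}"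
proof -
  let ?a = "\<lambda>i. if i < N then a i else 0"
  have eq: "(\<Sum>i<n. ?a i *\<^sub>R e i) = (\<Sum>i<N. a i *\<^sub>R e i)" if "n \<ge> N" for n
    using that by (intro sum.mono_neutral_cong_right) auto
  have "(\<lambda>n. \<Sum>i<n. ?a i *\<^sub>R e i) \<longlonglongrightarrow> (\<Sum>i<N. a i *\<^sub>R e i)"
    by (rule tendsto_eventually) (rule eventually_mono[OF eventually_ge_at_top[of N] eq])
  hence "basis_coeffs e (\<Sum>i<N. a i *\<^sub>R e i) = ?a" by (rule basis_coeffs_unique[OF e])
  thus ?thesis by (auto simp: basis_support_def)
qed

lemma basis_support_tail:
  assumes e: "schauder_basis e"
  shows "basis_support e (s *\<^sub>R (y - (\<Sum>i<N. basis_coeffs e y i *\<^sub>R e i))) \<subseteq> {N..}"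
proof -
  let ?c = "basis_coeffs e y"
  let ?a = "\<lambda>i. if i < N then 0 else s * ?c i"
  have eq: "(\<Sum>i<n. ?a i *\<^sub>R e i) = s *\<^sub>R ((\<Sum>i<n. ?c i *\<^sub>R e i) - (\<Sum>i<N. ?c i *\<^sub>R e i))" if "n \<ge> N" for n
  proof -
    have "(\<Sum>i<n. ?a i *\<^sub>R e i) = (\<Sum>i\<in>{..<n} - {..<N}. s *\<^sub>R (?c i *\<^sub>R e i))"
      by (intro sum.mono_neutral_cong_right) auto
    also have "\<dots> = s *\<^sub>R ((\<Sum>i<n. ?c i *\<^sub>R e i) - (\<Sum>i<N. ?c i *\<^sub>R e i))"
      using that by (subst sum_diff[symmetric]) (auto simp: scaleR_sum_right)
    finally show ?thesis .
  qed
  have "(\<lambda>n. s *\<^sub>R ((\<Sum>i<n. ?c i *\<^sub>R e i) - (\<Sum>i<N. ?c i *\<^sub>R e i))) \<longlonglongrightarrow> s *\<^sub>R (y - (\<Sum>i<N. ?c i *\<^sub>R e i))"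
    by (intro tendsto_intros basis_coeffs_limit[OF e])
  moreover have "\<forall>\<^sub>F n in sequentially. s *\<^sub>R ((\<Sum>i<n. ?c i *\<^sub>R e i) - (\<Sum>i<N. ?c i *\<^sub>R e i)) = (\<Sum>i<n. ?a i *\<^sub>R e i)"
    using eventually_ge_at_top[of N] eq[symmetric] by (rule eventually_mono)
  ultimately have "(\<lambda>n. \<Sum>i<n. ?a i *\<^sub>R e i) \<longlonglongrightarrow> s *\<^sub>R (y - (\<Sum>i<N. ?c i *\<^sub>R e i))"
    by (rule Lim_transform_eventually)
  hence "basis_coeffs e (s *\<^sub>R (y - (\<Sum>i<N. ?c i *\<^sub>R e i))) = ?a" by (rule basis_coeffs_unique[OF e])
  thus ?thesis by (auto simp: basis_support_def)
qed

text \<open>Head and tail have disjoint supports. The sign \<open>s\<close> lets one tail serve both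
  \<open>w + z\<close> and \<open>w - z\<close> later.\<close>

lemma lower_estimate_head_tail:
  assumes e: "schauder_basis e" and low: "lower_estimate_const1 e q" and s: "\<bar>s\<bar> = 1"
  defines "R \<equiv> \<lambda>N z. z - (\<Sum>i<N. basis_coeffs e z i *\<^sub>R e i)"
  shows "norm (\<Sum>i<N. a i *\<^sub>R e i) powr q + norm (R N z) powr q
           \<le> norm ((\<Sum>i<N. a i *\<^sub>R e i) + s *\<^sub>R R N z) powr q"
proof -
  define y where "y = (\<lambda>i::nat. if i = 0 then (\<Sum>i<N. a i *\<^sub>R e i) else s *\<^sub>R R N z)"
  have "basis_support e (y 0) \<inter> basis_support e (y 1) = {}"
    using basis_support_sum[OF e, of a N] basis_support_tail[OF e, of s z N]
    unfolding y_def R_def by fastforce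
  hence "\<forall>i<2. \<forall>j<2. i \<noteq> j \<longrightarrow> basis_support e (y i) \<inter> basis_support e (y j) = {}"
    by (auto simp: less_2_cases_iff)
  hence "(\<Sum>i<2. norm (y i) powr q) \<le> norm (\<Sum>i<2. y i) powr q"
    using low unfolding lower_estimate_const1_def by blast
  thus ?thesis using s by (simp add: y_def numeral_2_eq_2)
qed

lemma compact_coordinate_box:
  fixes e :: "nat \<Rightarrow> 'a::real_normed_vector"
  shows "\<exists>K. compact K \<and> (\<forall>a. (\<forall>i<N. norm (a i *\<^sub>R e i) \<le> M) \<longrightarrow> (\<Sum>i<N. a i *\<^sub>R e i) \<in> K)"
proof (induction N)
  case 0
  show ?case by (intro exI[of _ "{0}"]) auto
next
  case (Suc N)
  then obtain K where K: "compact K" "\<And>a. (\<forall>i<N. norm (a i *\<^sub>R e i) \<le> M) \<Longrightarrow> (\<Sum>i<N. a i *\<^sub>R e i) \<in> K"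
    by blast
  \<comment> \<open>For \<open>e N = 0\<close> the quotient \<open>M / norm (e N)\<close> is 0 by
    convention, and the interval is a single point.\<close>
  let ?S = "(\<lambda>t. t *\<^sub>R e N) ` {- (M / norm (e N))..M / norm (e N)}"
  have "compact ?S" by (intro compact_continuous_image continuous_intros compact_Icc)
  hence "compact {x + y | x y. x \<in> K \<and> y \<in> ?S}" using K(1) by (intro compact_sums)
  moreover have "(\<Sum>i<Suc N. a i *\<^sub>R e i) \<in> {x + y | x y. x \<in> K \<and> y \<in> ?S}"
    if a: "\<forall>i<Suc N. norm (a i *\<^sub>R e i) \<le> M" for a
  proof -
    have "(\<Sum>i<N. a i *\<^sub>R e i) \<in> K" using a by (intro K(2)) simp
    moreover have "a N *\<^sub>R e N \<in> ?S"
    proof (cases "e N = 0")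
      case False
      have "\<bar>a N\<bar> \<le> M / norm (e N)" using a False by (simp add: field_simps)
      thus ?thesis by (intro imageI) auto
    qed simp
    ultimately show ?thesis by auto
  qed
  ultimately show ?case by blast
qed

text \<open>Here \<open>z\<close> is an approximate midpoint of \<open>- w\<close> and
  \<open>w\<close>. A long initial block carries almost all of \<open>w\<close>, and one of
  \<open>w + z\<close>, \<open>w - z\<close> has essentially at least as large a head; the lower
  estimate then leaves little room for the tail of \<open>z\<close>, while its head stays in a
  compact box.\<close>

lemma lower_estimate_midpoints:
  fixes e :: "nat \<Rightarrow> 'a::real_normed_vector" and w :: 'a
  assumes e: "schauder_basis e" and low: "lower_estimate_const1 e q" and q: "1 \<le> q"
    and d: "0 < d" "d \<le> 1"
  shows "\<exists>K. compact K \<and> (\<forall>z. norm (w - z) \<le> (1 + d) * norm w \<and> norm (w + z) \<le> (1 + d) * norm w \<longrightarrow>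
           (\<exists>k\<in>K. norm (z - k) \<le> ((3 powr q + 1) * d) powr (1 / q) * norm w))"
proof (cases "w = 0")
  case True
  thus ?thesis by (intro exI[of _ "{0}"]) auto
next
  case False
  define P where "P N z = (\<Sum>i<N. basis_coeffs e z i *\<^sub>R e i)" for N z
  let ?W = "norm w"
  have W: "?W > 0" using False by simp
  have lim: "(\<lambda>N. P N w) \<longlonglongrightarrow> w" unfolding P_def by (rule basis_coeffs_limit[OF e])
  have "(\<lambda>N. norm (P N w) powr q) \<longlonglongrightarrow> ?W powr q"
    using W lim by (intro tendsto_powr tendsto_norm tendsto_const) auto
  moreover have "(1 - d) * ?W powr q < ?W powr q" using d W by (simp add: mult_less_cancel_right1)
  ultimately have "\<forall>\<^sub>F N in sequentially. (1 - d) * ?W powr q < norm (P N w) powr q"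
    by (rule order_tendstoD)
  moreover have "\<forall>\<^sub>F N in sequentially. norm (P N w - w) < d * ?W"
    using tendstoD[OF lim, of "d * ?W"] d W by (simp add: dist_norm)
  ultimately obtain N where N: "(1 - d) * ?W powr q < norm (P N w) powr q" "norm (P N w - w) < d * ?W"
    using eventually_happens[OF eventually_conj] by (metis (no_types, lifting) sequentially_bot)
  \<comment> \<open>Each coordinate vector of \<open>z\<close> is a difference of two partial sums
    of norm at most \<open>norm z \<le> 2 * norm w\<close>; hence the factor 4.\<close>
  obtain K where K: "compact K" "\<And>a. (\<forall>i<N. norm (a i *\<^sub>R e i) \<le> 4 * ?W) \<Longrightarrow> (\<Sum>i<N. a i *\<^sub>R e i) \<in> K"
    using compact_coordinate_box[of N e "4 * ?W"] by blast
  have head: "norm (P n z) \<le> norm z" for n z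
  proof -
    have "norm (P n z) powr q + norm (z - P n z) powr q \<le> norm z powr q"
      using lower_estimate_head_tail[OF e low, of 1 "basis_coeffs e z" n z] unfolding P_def by simp
    hence "norm (P n z) powr q \<le> norm z powr q"
      using powr_ge_zero[of "norm (z - P n z)" q] by linarith
    thus ?thesis using q powr_less_mono2[of q "norm z" "norm (P n z)"] by force
  qed
  have "\<exists>k\<in>K. norm (z - k) \<le> ((3 powr q + 1) * d) powr (1 / q) * ?W"
    if z: "norm (w - z) \<le> (1 + d) * ?W" "norm (w + z) \<le> (1 + d) * ?W" for z
  proof
    have "norm (2 *\<^sub>R z) \<le> norm (w + z) + norm (w - z)"
      using norm_triangle_ineq4[of "w + z" "w - z"] by (simp add: algebra_simps scaleR_2)
    hence "norm z \<le> (1 + d) * ?W" using z by simp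
    also have "\<dots> \<le> 2 * ?W" using d W by simp
    finally have z2: "norm z \<le> 2 * ?W" .
    have "norm (basis_coeffs e z i *\<^sub>R e i) \<le> 4 * ?W" for i
    proof -
      have "basis_coeffs e z i *\<^sub>R e i = P (Suc i) z - P i z" by (simp add: P_def)
      thus ?thesis using norm_triangle_ineq4[of "P (Suc i) z" "P i z"] head[of "Suc i" z] head[of i z] z2 by simp
    qed
    thus "P N z \<in> K" unfolding P_def by (intro K(2)) simp
    let ?R = "z - P N z"
    have key: "norm (P N w) powr q + norm ?R powr q \<le> ((1 + 2 * d) * ?W) powr q"
    proof -
      \<comment> \<open>Replacing \<open>w\<close> by its head turns \<open>1 + d\<close> into
        \<open>1 + 2 * d\<close> and makes the tail of the sum equal to that of \<open>z\<close> up
        to sign, so the lower estimate splits it off.\<close>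
      have A: "norm (P N w + s *\<^sub>R P N z) powr q + norm ?R powr q \<le> ((1 + 2 * d) * ?W) powr q"
        if s: "\<bar>s\<bar> = 1" "norm (w + s *\<^sub>R z) \<le> (1 + d) * ?W" for s
      proof -
        have eq: "(\<Sum>i<N. (basis_coeffs e w i + s * basis_coeffs e z i) *\<^sub>R e i) = P N w + s *\<^sub>R P N z"
          by (simp add: P_def sum.distrib scaleR_left_distrib scaleR_sum_right)
        have "norm (P N w + s *\<^sub>R P N z) powr q + norm ?R powr q \<le> norm (P N w + s *\<^sub>R P N z + s *\<^sub>R ?R) powr q"
          using lower_estimate_head_tail[OF e low s(1), of "\<lambda>i. basis_coeffs e w i + s * basis_coeffs e z i" N z]
          unfolding eq P_def by simp
        also have "P N w + s *\<^sub>R P N z + s *\<^sub>R ?R = (w + s *\<^sub>R z) + (P N w - w)"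
          by (simp add: algebra_simps)
        also have "norm \<dots> powr q \<le> ((1 + 2 * d) * ?W) powr q"
          using q s(2) N(2) norm_triangle_ineq[of "w + s *\<^sub>R z" "P N w - w"]
          by (intro powr_mono2) (auto simp: algebra_simps)
        finally show ?thesis .
      qed
      \<comment> \<open>The vectors \<open>P N w \<plusminus> P N z\<close> average to
        \<open>P N w\<close>; the sign of the longer one decides which instance of \<open>A\<close>
        is used.\<close>
      have "norm (2 *\<^sub>R P N w) \<le> norm (P N w + P N z) + norm (P N w - P N z)"
        using norm_triangle_ineq[of "P N w + P N z" "P N w - P N z"] by (simp add: algebra_simps scaleR_2)
      hence "norm (P N w) \<le> norm (P N w + P N z) \<or> norm (P N w) \<le> norm (P N w - P N z)" by auto
      hence "norm (P N w) powr q \<le> norm (P N w + P N z) powr q \<or> norm (P N w) powr q \<le> norm (P N w - P N z) powr q"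
        using q by (auto intro: powr_mono2)
      thus ?thesis using A[of 1] A[of "- 1"] z by auto
    qed
    have "((1 + 2 * d) * ?W) powr q = (1 + 2 * d) powr q * ?W powr q"
      using d W by (simp add: powr_mult)
    also have "\<dots> \<le> (1 + 3 powr q * d) * ?W powr q"
      using one_plus_powr_le[OF q, of 2 d] d by (intro mult_right_mono) auto
    \<comment> \<open>The head takes more than \<open>1 - d\<close> out of
      \<open>1 + 3 powr q * d\<close>, in units of \<open>norm w powr q\<close>; the rest bounds the
      tail.\<close>
    finally have "norm ?R powr q \<le> ((3 powr q + 1) * d) * ?W powr q"
      using key N(1) by (simp add: algebra_simps)
    hence "(norm ?R powr q) powr (1 / q) \<le> (((3 powr q + 1) * d) * ?W powr q) powr (1 / q)"
      using q by (intro powr_mono2) auto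
    also have "\<dots> = ((3 powr q + 1) * d) powr (1 / q) * (?W powr q) powr (1 / q)"
      by (rule powr_mult)
    finally show "norm ?R \<le> ((3 powr q + 1) * d) powr (1 / q) * ?W"
      using q by (simp add: powr_powr)
  qed
  thus ?thesis using K(1) by blast
qed

subsection \<open>Coarse Lipschitz maps and approximate midpoints\<close>

lemma small_powr_exists:
  fixes \<beta> M \<delta> d0 :: real
  assumes "\<beta> > 0" "M > 0" "\<delta> > 0" "d0 > 0"
  obtains d where "0 < d" "d \<le> d0" "M * d powr \<beta> \<le> \<delta>"
proof (rule that)
  let ?d = "min d0 ((\<delta> / M) powr (1 / \<beta>))"
  show "0 < ?d" "?d \<le> d0" using assms by auto
  have "?d powr \<beta> \<le> ((\<delta> / M) powr (1 / \<beta>)) powr \<beta>" using assms by (intro powr_mono2) auto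
  also have "\<dots> = \<delta> / M" using assms by (simp add: powr_powr)
  finally show "M * ?d powr \<beta> \<le> \<delta>" using assms by (simp add: field_simps)
qed

lemma finite_net_of_compact:
  fixes K :: "'a::metric_space set"
  assumes "compact K" "\<epsilon> > 0"
  obtains A where "finite A" "\<And>k. k \<in> K \<Longrightarrow> \<exists>a\<in>A. dist k a \<le> \<epsilon>"
proof -
  obtain A where A: "finite A" "K \<subseteq> (\<Union>x\<in>A. ball x \<epsilon>)"
    using compactE_image[OF assms(1), of K "\<lambda>x. ball x \<epsilon>"] assms(2) by (metis UN_I centre_in_ball open_ball subsetI)
  show ?thesis
  proof (rule that[OF A(1)])
    fix k assume "k \<in> K"
    then obtain a where "a \<in> A" "dist a k < \<epsilon>" using A(2) by auto
    thus "\<exists>a\<in>A. dist k a \<le> \<epsilon>" by (intro bexI[of _ a]) (auto simp: dist_commute)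
  qed
qed

text \<open>In the proof, \<open>lam\<close> is the Lipschitz constant of \<open>f\<close> at infinity; either it is below \<open>\<delta>\<close>, or
  pairs of points that almost attain it exist at every scale.\<close>

lemma coarse_lipschitz_midpoints:
  fixes f :: "'a::real_normed_vector \<Rightarrow> 'b::real_normed_vector"
  assumes L: "L > 0" and f: "\<And>x y. norm (f x - f y) \<le> L * norm (x - y) + L"
    and "\<delta> > 0" and \<kappa>: "0 < \<kappa>" "\<kappa> \<le> 1 / 2"
  shows "(\<exists>s\<ge>1. \<forall>x y. s \<le> norm (x - y) \<longrightarrow> norm (f x - f y) \<le> \<delta> * norm (x - y)) \<or>
    (\<forall>s. \<exists>x y. s \<le> norm (x - y) \<and>
      (\<forall>z. norm (x - z) \<le> (1 + \<kappa>) / 2 * norm (x - y) \<and> norm (y - z) \<le> (1 + \<kappa>) / 2 * norm (x - y) \<longrightarrow>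
        norm (f x - f z) \<le> (1 + 2 * \<kappa>) / 2 * norm (f x - f y) \<and>
        norm (f y - f z) \<le> (1 + 2 * \<kappa>) / 2 * norm (f x - f y)))"
proof -
  define \<Lambda> where "\<Lambda> = {c. 0 \<le> c \<and> (\<exists>s\<ge>1. \<forall>x y. s \<le> norm (x - y) \<longrightarrow> norm (f x - f y) \<le> c * norm (x - y))}"
  define lam where "lam = Inf \<Lambda>"
  have "norm (f x - f y) \<le> 2 * L * norm (x - y)" if "1 \<le> norm (x - y)" for x y
    using f[of x y] mult_left_mono[OF that, of L] L by linarith
  hence ne: "2 * L \<in> \<Lambda>" using L unfolding \<Lambda>_def by (auto intro!: exI[of _ 1])
  have bdd: "bdd_below \<Lambda>" by (rule bdd_belowI[of _ 0]) (auto simp: \<Lambda>_def)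
  have lam0: "0 \<le> lam" 
  proof -
    have "\<Lambda> \<noteq> {}" using ne by blast
    thus ?thesis unfolding lam_def by (rule cInf_greatest) (simp add: \<Lambda>_def)
  qed
  have above: "c \<in> \<Lambda>" if c: "lam < c" for c
  proof -
    obtain c' where c': "c' \<in> \<Lambda>" "c' < c"
      using c ne bdd unfolding lam_def by (metis cInf_less_iff empty_iff)
    then obtain s where s: "s \<ge> 1" "\<And>x y. s \<le> norm (x - y) \<Longrightarrow> norm (f x - f y) \<le> c' * norm (x - y)" "0 \<le> c'"
      by (auto simp: \<Lambda>_def)
    have "norm (f x - f y) \<le> c * norm (x - y)" if "s \<le> norm (x - y)" for x y
      using s(2)[OF that] mult_right_mono[of c' c "norm (x - y)"] c'(2) by simp
    thus ?thesis using s c'(2) unfolding \<Lambda>_def by auto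
  qed
  have below: "c \<notin> \<Lambda>" if "c < lam" for c
    using that cInf_lower[OF _ bdd, of c] unfolding lam_def by auto
  show ?thesis
  proof (cases "lam < \<delta>")
    case True
    thus ?thesis using above[of \<delta>] by (auto simp: \<Lambda>_def)
  next
    case False
    hence lam: "lam > 0" using \<open>\<delta> > 0\<close> by simp
    \<comment> \<open>The slope \<open>c1\<close> is admissible and \<open>c2\<close> is not. The
      eighths are small enough that trading \<open>c1\<close> for \<open>c2\<close> raises the
      factor \<open>1 + \<kappa>\<close> to at most \<open>1 + 2 * \<kappa>\<close>.\<close>
    define c1 c2 where "c1 = lam * (1 + \<kappa> / 8)" and "c2 = lam * (1 - \<kappa> / 8)"
    have c12: "lam < c1" "c2 < lam" "0 \<le> c2" using lam \<kappa> by (auto simp: c1_def c2_def)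
    have "\<kappa> * \<kappa> \<le> \<kappa> * (1 / 2)" using \<kappa> by (intro mult_left_mono) auto
    moreover have "(1 + 2 * \<kappa>) * (1 - \<kappa> / 8) - (1 + \<kappa> / 8) * (1 + \<kappa>) = 3 / 4 * \<kappa> - 3 / 8 * (\<kappa> * \<kappa>)"
      by (simp add: field_simps)
    ultimately have "(1 + \<kappa> / 8) * (1 + \<kappa>) \<le> (1 + 2 * \<kappa>) * (1 - \<kappa> / 8)"
      using \<kappa> by linarith
    hence ratio: "c1 * (1 + \<kappa>) \<le> (1 + 2 * \<kappa>) * c2"
      using mult_left_mono[of _ _ lam] lam by (fastforce simp: c1_def c2_def ac_simps)
    obtain s1 where s1: "s1 \<ge> 1" "\<And>x y. s1 \<le> norm (x - y) \<Longrightarrow> norm (f x - f y) \<le> c1 * norm (x - y)"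
      using above[OF c12(1)] by (auto simp: \<Lambda>_def)
    have "\<exists>x y. s \<le> norm (x - y) \<and>
      (\<forall>z. norm (x - z) \<le> (1 + \<kappa>) / 2 * norm (x - y) \<and> norm (y - z) \<le> (1 + \<kappa>) / 2 * norm (x - y) \<longrightarrow>
        norm (f x - f z) \<le> (1 + 2 * \<kappa>) / 2 * norm (f x - f y) \<and>
        norm (f y - f z) \<le> (1 + 2 * \<kappa>) / 2 * norm (f x - f y))" for s
    proof -
      \<comment> \<open>An approximate midpoint is within \<open>3 / 4\<close> of the distance from
        either end, hence at least a quarter away from both; \<open>4 * s1\<close> thus keeps the
        slope bound \<open>c1\<close> applicable.\<close>
      obtain x y where xy: "max s (4 * s1) \<le> norm (x - y)" "c2 * norm (x - y) < norm (f x - f y)"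
      proof -
        have "max s (4 * s1) \<ge> 1" using s1(1) by simp
        hence "\<not> (\<forall>x y. max s (4 * s1) \<le> norm (x - y) \<longrightarrow> norm (f x - f y) \<le> c2 * norm (x - y))"
          using below[OF c12(2)] c12(3) unfolding \<Lambda>_def by blast
        thus ?thesis using that by (meson not_le)
      qed
      define D where "D = norm (x - y)"
      have D: "D \<ge> 4 * s1" "D > 0" using xy s1(1) by (auto simp: D_def)
      have half: "norm (f a - f z) \<le> (1 + 2 * \<kappa>) / 2 * norm (f x - f y)"
        if "norm (a - z) \<le> (1 + \<kappa>) / 2 * D" "norm (b - z) \<le> (1 + \<kappa>) / 2 * D" "norm (a - b) = D" for a b z
      proof -
        have "D \<le> norm (a - z) + norm (b - z)"
          using norm_triangle_ineq4[of "a - z" "b - z"] that(3) by simp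
        moreover have "(1 + \<kappa>) / 2 * D \<le> 3 / 4 * D" using \<kappa> D by (intro mult_right_mono) auto
        ultimately have "s1 \<le> norm (a - z)" using that D by linarith
        hence "norm (f a - f z) \<le> c1 * norm (a - z)" by (rule s1(2))
        also have "\<dots> \<le> c1 * ((1 + \<kappa>) / 2 * D)" using that(1) c12 lam by (intro mult_left_mono) auto
        also have "\<dots> = c1 * (1 + \<kappa>) * (D / 2)" by simp
        also have "\<dots> \<le> (1 + 2 * \<kappa>) * c2 * (D / 2)" using ratio D by (intro mult_right_mono) auto
        also have "\<dots> = (1 + 2 * \<kappa>) / 2 * (c2 * D)" by simp
        also have "\<dots> \<le> (1 + 2 * \<kappa>) / 2 * norm (f x - f y)"
          using xy(2) \<kappa> by (intro mult_left_mono) (auto simp: D_def)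
        finally show ?thesis .
      qed
      show ?thesis
      proof (rule exI[of _ x], rule exI[of _ y], intro conjI allI impI)
        show "s \<le> norm (x - y)" using xy(1) by simp
      next
        fix z assume z: "norm (x - z) \<le> (1 + \<kappa>) / 2 * norm (x - y) \<and> norm (y - z) \<le> (1 + \<kappa>) / 2 * norm (x - y)"
        show "norm (f x - f z) \<le> (1 + 2 * \<kappa>) / 2 * norm (f x - f y)"
          by (rule half[of x z y]) (use z in \<open>auto simp: D_def\<close>)
        show "norm (f y - f z) \<le> (1 + 2 * \<kappa>) / 2 * norm (f x - f y)"
          by (rule half[of y z x]) (use z in \<open>auto simp: D_def norm_minus_commute\<close>)
      qed
    qed
    thus ?thesis by blast
  qed
qed

text \<open>Relative to the distance of a nearly extremal pair, the ball in \<open>E\<close> has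
  radius of order \<open>d powr (1 / p)\<close> and its image lies within order
  \<open>d powr (1 / q)\<close> of a compact set. The quotient is of order
  \<open>d powr \<beta>\<close> with \<open>\<beta> > 0\<close>, so a small \<open>d\<close> brings
  it below \<open>\<delta>\<close>.\<close>

lemma coarse_lipschitz_flat_on_fin_codim:
  fixes f :: "'a::real_normed_vector \<Rightarrow> 'b::real_normed_vector" and t \<delta> :: real
  assumes L: "L > 0" and f: "\<And>x y. norm (f x - f y) \<le> L * norm (x - y) + L"
    and aus: "asymptotically_uniformly_smooth_power TYPE('a::real_normed_vector) p"
    and e: "schauder_basis (e :: nat \<Rightarrow> 'b)" and low: "lower_estimate_const1 e q"
    and q: "1 \<le> q" "q < p" and \<delta>: "\<delta> > 0"
  shows "\<exists>u \<tau> E A. t < \<tau> \<and> 0 < \<tau> \<and> fin_codim_subspace E \<and> finite A \<and>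
    (\<forall>h\<in>E. norm h \<le> \<tau> \<longrightarrow> (\<exists>a\<in>A. norm (f (u + h) - a) \<le> \<delta> * \<tau>))"
proof -
  obtain C where C: "C \<ge> 1"
    "\<And>(z::'a) t. norm z = 1 \<Longrightarrow> 0 < t \<Longrightarrow> t \<le> 1 \<Longrightarrow>
       \<exists>E. fin_codim_subspace E \<and> (\<forall>h\<in>E. norm h \<le> t \<longrightarrow> norm (z + h) \<le> 1 + C * t powr p)"
    using asym_smooth_finite_codim[OF aus] by blast
  define \<beta> where "\<beta> = 1 / q - 1 / p"
  have \<beta>: "\<beta> > 0" using q by (simp add: \<beta>_def field_simps)
  define M where "M = ((3 powr q + 1) * (2 * C)) powr (1 / q) * (2 * L)"
  have "(3 powr q + 1) * (2 * C) > 0"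
    using C(1) powr_ge_zero[of 3 q] by (intro mult_pos_pos) linarith+
  hence "((3 powr q + 1) * (2 * C)) powr (1 / q) > 0" by (metis powr_gt_zero less_irrefl)
  hence M: "M > 0" using L by (simp add: M_def)
  \<comment> \<open>The bound \<open>1 / (2 * C)\<close> makes \<open>\<kappa> \<le> 1 / 2\<close>;
    using only \<open>\<delta> / 2\<close> leaves the other half for replacing the compact set by a
    finite net.\<close>
  obtain d where d: "0 < d" "d \<le> 1 / (2 * C)" "M * d powr \<beta> \<le> \<delta> / 2"
    using small_powr_exists[OF \<beta> M, of "\<delta> / 2" "1 / (2 * C)"] \<delta> C by auto
  define \<kappa> where "\<kappa> = C * d"
  have \<kappa>: "0 < \<kappa>" "\<kappa> \<le> 1 / 2" using d C by (auto simp: \<kappa>_def field_simps)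
  have "1 / (2 * C) \<le> 1" using C(1) by simp
  hence d1: "d \<le> 1" using d(2) by linarith
  define \<theta> where "\<theta> = d powr (1 / p)"
  have \<theta>: "0 < \<theta>" "\<theta> \<le> 1" "\<theta> powr p = d"
    using d d1 q by (auto simp: \<theta>_def powr_powr powr_le1)
  from coarse_lipschitz_midpoints[OF L f \<delta> \<kappa>] show ?thesis
  proof
    \<comment> \<open>With slope at most \<open>\<delta>\<close> at large distances the whole space
      serves as \<open>E\<close> and \<open>{f 0}\<close> as \<open>A\<close>; a large
      \<open>\<tau>\<close> also absorbs the displacement at distances below
      \<open>s\<close>.\<close>
    assume "\<exists>s\<ge>1. \<forall>x y. s \<le> norm (x - y) \<longrightarrow> norm (f x - f y) \<le> \<delta> * norm (x - y)"
    then obtain s where s: "s \<ge> 1" "\<And>x y. s \<le> norm (x - y) \<Longrightarrow> norm (f x - f y) \<le> \<delta> * norm (x - y)" by blast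
    define \<tau> where "\<tau> = max (max (t + 1) 1) ((L * s + L) / \<delta>)"
    have "(L * s + L) / \<delta> \<le> \<tau>" by (simp add: \<tau>_def)
    hence "L * s + L \<le> \<delta> * \<tau>" using \<delta> by (simp add: pos_divide_le_eq mult.commute)
    moreover have "t < \<tau>" "0 < \<tau>" by (auto simp: \<tau>_def)
    ultimately have \<tau>: "t < \<tau>" "0 < \<tau>" "L * s + L \<le> \<delta> * \<tau>" by auto
    have "norm (f (0 + h) - f 0) \<le> \<delta> * \<tau>" if "norm h \<le> \<tau>" for h
    proof (cases "s \<le> norm h")
      case True
      hence "norm (f (0 + h) - f 0) \<le> \<delta> * norm h" using s(2)[of h 0] by simp
      also have "\<dots> \<le> \<delta> * \<tau>" using that \<delta> by (intro mult_left_mono) auto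
      finally show ?thesis .
    next
      case False
      have "norm (f (0 + h) - f 0) \<le> L * norm h + L" using f[of h 0] by simp
      also have "\<dots> \<le> L * s + L" using False L by simp
      finally show ?thesis using \<tau>(3) by simp
    qed
    moreover have "fin_codim_subspace (UNIV :: 'a set)"
      by (auto simp: fin_codim_subspace_def intro!: exI[of _ "{}"])
    ultimately show ?thesis using \<tau>
      by (intro exI[of _ 0] exI[of _ \<tau>] exI[of _ UNIV] exI[of _ "{f 0}"]) auto
  next
    let ?mid = "\<lambda>x y z. norm (x - z) \<le> (1 + \<kappa>) / 2 * norm (x - y) \<and> norm (y - z) \<le> (1 + \<kappa>) / 2 * norm (x - y)"
    let ?mid' = "\<lambda>x y z. norm (f x - f z) \<le> (1 + 2 * \<kappa>) / 2 * norm (f x - f y) \<and>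
      norm (f y - f z) \<le> (1 + 2 * \<kappa>) / 2 * norm (f x - f y)"
    assume "\<forall>s. \<exists>x y. s \<le> norm (x - y) \<and> (\<forall>z. ?mid x y z \<longrightarrow> ?mid' x y z)"
    \<comment> \<open>The lower bound on the distance yields \<open>t < \<tau>\<close>, and its part
      1 lets the additive \<open>L\<close> be absorbed into the slope.\<close>
    then obtain x y where xy: "max 1 (2 * (\<bar>t\<bar> + 1) / \<theta>) \<le> norm (x - y)" "\<And>z. ?mid x y z \<Longrightarrow> ?mid' x y z"
      by blast
    \<comment> \<open>With \<open>u\<close> the exact midpoint and \<open>v\<close> half the
      difference, \<open>u + h\<close> is an approximate midpoint when \<open>v + h\<close> and
      \<open>v - h\<close> are hardly longer than \<open>v\<close>.\<close>
    define v u where "v = (1 / 2) *\<^sub>R (x - y)" and "u = (1 / 2) *\<^sub>R (x + y)"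
    define V where "V = norm v"
    have xyV: "norm (x - y) = 2 * V" by (simp add: V_def v_def)
    have V: "V > 0" "2 * V \<ge> 1" using xy(1) xyV by auto
    define \<tau> where "\<tau> = \<theta> * V"
    have "2 * (\<bar>t\<bar> + 1) / \<theta> \<le> 2 * V" using xy(1) xyV by simp
    hence \<tau>: "t < \<tau>" "0 < \<tau>" using \<theta> V by (auto simp: \<tau>_def field_simps)
    have "norm (v /\<^sub>R V) = 1" using V by (simp add: V_def)
    then obtain E where E: "fin_codim_subspace E"
      "\<And>h. h \<in> E \<Longrightarrow> norm h \<le> \<theta> \<Longrightarrow> norm (v /\<^sub>R V + h) \<le> 1 + \<kappa>"
      using C(2)[of "v /\<^sub>R V" \<theta>] \<theta> by (auto simp: \<kappa>_def)
    have vh: "norm (v + h) \<le> (1 + \<kappa>) * V" if h: "h \<in> E" "norm h \<le> \<tau>" for h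
    proof -
      have "norm (v /\<^sub>R V + h /\<^sub>R V) \<le> 1 + \<kappa>"
        using h V E(1) by (intro E(2)) (auto simp: fin_codim_subspace_def subspace_scale \<tau>_def field_simps)
      hence "V * norm (v /\<^sub>R V + h /\<^sub>R V) \<le> V * (1 + \<kappa>)" using V by simp
      moreover have "norm (v + h) = V * norm (v /\<^sub>R V + h /\<^sub>R V)"
        using V by (simp add: scaleR_right_distrib[symmetric])
      ultimately show ?thesis by (simp add: mult.commute)
    qed
    define w m where "w = (1 / 2) *\<^sub>R (f x - f y)" and "m = (1 / 2) *\<^sub>R (f x + f y)"
    have \<kappa>2: "0 < 2 * \<kappa>" "2 * \<kappa> \<le> 1" using \<kappa> by auto
    obtain K where K: "compact K"
      "\<And>z. norm (w - z) \<le> (1 + 2 * \<kappa>) * norm w \<Longrightarrow> norm (w + z) \<le> (1 + 2 * \<kappa>) * norm w \<Longrightarrow>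
           \<exists>k\<in>K. norm (z - k) \<le> ((3 powr q + 1) * (2 * \<kappa>)) powr (1 / q) * norm w"
      using lower_estimate_midpoints[OF e low q(1) \<kappa>2, of w] by blast
    have rad: "((3 powr q + 1) * (2 * \<kappa>)) powr (1 / q) * norm w \<le> \<delta> / 2 * \<tau>"
    proof -
      have "norm (f x - f y) \<le> L * (2 * V) + L * (2 * V)"
        using f[of x y] mult_left_mono[OF V(2), of L] L unfolding xyV by linarith
      hence w: "norm w \<le> 2 * L * V" by (simp add: w_def)
      have "((3 powr q + 1) * (2 * \<kappa>)) powr (1 / q) = ((3 powr q + 1) * (2 * C)) powr (1 / q) * d powr (1 / q)"
        by (simp add: \<kappa>_def powr_mult flip: mult.assoc)
      hence "((3 powr q + 1) * (2 * \<kappa>)) powr (1 / q) * norm w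
          \<le> ((3 powr q + 1) * (2 * C)) powr (1 / q) * d powr (1 / q) * (2 * L * V)"
        using w by (simp add: mult_left_mono)
      also have "d powr (1 / q) = d powr \<beta> * \<theta>" by (simp add: \<beta>_def \<theta>_def powr_add[symmetric])
      also have "((3 powr q + 1) * (2 * C)) powr (1 / q) * (d powr \<beta> * \<theta>) * (2 * L * V) = M * d powr \<beta> * \<tau>"
        by (simp add: M_def \<tau>_def)
      also have "\<dots> \<le> \<delta> / 2 * \<tau>" using d(3) \<tau> by (intro mult_right_mono) auto
      finally show ?thesis .
    qed
    have "\<delta> / 2 * \<tau> > 0" using \<delta> \<tau> by simp
    then obtain A where A: "finite A" "\<And>k. k \<in> K \<Longrightarrow> \<exists>a\<in>A. dist k a \<le> \<delta> / 2 * \<tau>"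
      using finite_net_of_compact[OF K(1)] by metis
    have "\<exists>a\<in>(+) m ` A. norm (f (u + h) - a) \<le> \<delta> * \<tau>" if h: "h \<in> E" "norm h \<le> \<tau>" for h
    proof -
      let ?z = "u + h"
      have "- h \<in> E" using h E(1) by (simp add: fin_codim_subspace_def subspace_neg)
      hence "norm (v - h) \<le> (1 + \<kappa>) * V" using vh[of "- h"] h by simp
      moreover have xz: "x - ?z = v - h" "y - ?z = - (v + h)"
        by (simp_all add: v_def u_def algebra_simps flip: scaleR_left_distrib)
      ultimately have "?mid x y ?z" using vh[OF h] unfolding xz xyV norm_minus_cancel by simp
      hence mid': "?mid' x y ?z" by (rule xy(2))
      have eqs: "w - (f ?z - m) = f x - f ?z" "w + (f ?z - m) = - (f y - f ?z)"
        by (simp_all add: w_def m_def algebra_simps flip: scaleR_left_distrib)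
      have "\<exists>k\<in>K. norm (f ?z - m - k) \<le> ((3 powr q + 1) * (2 * \<kappa>)) powr (1 / q) * norm w"
        using mid' by (intro K(2)) (simp_all only: eqs norm_minus_cancel, simp_all add: w_def)
      then obtain k where k: "k \<in> K" "norm (f ?z - m - k) \<le> \<delta> / 2 * \<tau>" using rad order_trans by blast
      obtain a where a: "a \<in> A" "dist k a \<le> \<delta> / 2 * \<tau>" using A(2)[OF k(1)] by blast
      have "norm (f ?z - (m + a)) \<le> norm (f ?z - m - k) + norm (k - a)"
        using norm_triangle_ineq[of "f ?z - m - k" "k - a"] by (simp add: algebra_simps)
      also have "\<dots> \<le> \<delta> * \<tau>" using k a by (simp add: dist_norm)
      finally show ?thesis using a(1) by blast
    qed
    thus ?thesis using \<tau> E(1) A(1) by blast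
  qed
qed

subsection \<open>Non-embeddability\<close>

lemma coarse_lipschitz_embeddingE:
  fixes f :: "'a::real_normed_vector \<Rightarrow> 'b::real_normed_vector"
  assumes "coarse_lipschitz_embedding f"
  obtains L where "L > 0" "\<And>x y. norm (f x - f y) \<le> L * norm (x - y) + L"
    "\<And>x y. norm (x - y) / L - L \<le> norm (f x - f y)"
proof -
  obtain L where L: "L > 0" "\<And>t. t \<ge> 0 \<Longrightarrow> omega_f f t \<le> ereal (L * t + L)"
    "\<And>t. t \<ge> 0 \<Longrightarrow> ereal (t / L - L) \<le> rho_f f t"
    using assms by (auto simp: coarse_lipschitz_embedding_def)
  have "norm (f x - f y) \<le> L * norm (x - y) + L" for x y
  proof -
    have "ereal (norm (f (fst (x, y)) - f (snd (x, y)))) \<le> omega_f f (norm (x - y))"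
      unfolding omega_f_def by (rule SUP_upper) simp
    also have "\<dots> \<le> ereal (L * norm (x - y) + L)" by (rule L(2)) simp
    finally show ?thesis by simp
  qed
  moreover have "norm (x - y) / L - L \<le> norm (f x - f y)" for x y
  proof -
    have "ereal (norm (x - y) / L - L) \<le> rho_f f (norm (x - y))" by (rule L(3)) simp
    also have "\<dots> \<le> ereal (norm (f (fst (x, y)) - f (snd (x, y))))"
      unfolding rho_f_def by (rule INF_lower) simp
    finally show ?thesis by simp
  qed
  ultimately show ?thesis using L(1) that by blast
qed

text \<open>A weakly null \<open>d\<close> eventually lies, up to the slack \<open>\<eta>\<close>,
  in the subspace belonging to \<open>s\<close>. The filter is arbitrary because the differences in
  the concentration argument are known to be weakly null only along an ultrafilter.\<close>

lemma asym_smooth_filter_step: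
  assumes aus: "asymptotically_uniformly_smooth_power TYPE('a::banach) r" and r: "1 \<le> r"
  obtains C where "C > 0"
    "\<forall>(F::nat filter) (s::'a) d. (\<forall>g::'a \<Rightarrow>\<^sub>L real. ((\<lambda>n. blinfun_apply g (d n)) \<longlongrightarrow> 0) F) \<longrightarrow>
      (\<forall>n. norm (d n) \<le> 1) \<longrightarrow> (\<forall>\<^sub>F n in F. norm (s + d n) powr r \<le> norm s powr r + C)"
proof -
  obtain C where C: "C > 0"
    "\<And>s::'a. \<exists>E B. fin_codim_subspace E \<and> B powr r \<le> norm s powr r + C \<and>
        (\<exists>\<eta>>0. \<forall>h\<in>E. norm h \<le> 1 \<longrightarrow> norm (s + h) + \<eta> \<le> B)"
    using asym_smooth_power_step[OF aus r] by blast
  have "\<forall>\<^sub>F n in F. norm (s + d n) powr r \<le> norm s powr r + C"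
    if d: "\<And>g::'a \<Rightarrow>\<^sub>L real. ((\<lambda>n. blinfun_apply g (d n)) \<longlongrightarrow> 0) F" "\<And>n. norm (d n) \<le> 1"
    for F :: "nat filter" and s :: 'a and d
  proof -
    obtain E B \<eta> where E: "fin_codim_subspace E" "B powr r \<le> norm s powr r + C" "\<eta> > 0"
      "\<And>h. h \<in> E \<Longrightarrow> norm h \<le> 1 \<Longrightarrow> norm (s + h) + \<eta> \<le> B" using C(2)[of s] by blast
    have "\<forall>\<^sub>F n in F. norm (s + d n) \<le> B"
      by (rule weakly_null_near_fin_codim[OF E(1,3) E(4) d])
    thus ?thesis
    proof eventually_elim
      case (elim n)
      thus ?case using powr_mono2[of r "norm (s + d n)" B] E(2) r by simp
    qed
  qed
  thus ?thesis using C(1) that by blast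
qed

lemma weakly_null_subseq:
  fixes x :: "nat \<Rightarrow> 'a::real_normed_vector"
  assumes "weakly_null x" "strict_mono \<sigma>"
  shows "weakly_null (\<lambda>n. x (\<sigma> n))"
  unfolding weakly_null_def
proof
  fix g :: "'a \<Rightarrow>\<^sub>L real"
  show "(\<lambda>n. blinfun_apply g (x (\<sigma> n))) \<longlonglongrightarrow> 0"
    using LIMSEQ_subseq_LIMSEQ[OF assms(1)[unfolded weakly_null_def, rule_format, of g] assms(2)]
    by (simp add: o_def)
qed

lemma co_banach_saks_sequence:
  assumes "infinite_dimensional TYPE('a::real_normed_vector)"
    and "asymptotically_uniformly_smooth_power TYPE('a::real_normed_vector) p" and "p > 1"
    and cbs: "co_banach_saks TYPE('a::real_normed_vector) p"
  obtains x :: "nat \<Rightarrow> 'a::real_normed_vector" and c where "\<And>n. norm (x n) = 1" "weakly_null x" "c > 0"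
    "\<And>A. finite A \<Longrightarrow> (\<And>j. j \<in> A \<Longrightarrow> card A \<le> j) \<Longrightarrow> c * real (card A) powr (1 / p) \<le> norm (\<Sum>j\<in>A. x j)"
proof -
  obtain x :: "nat \<Rightarrow> 'a" where x: "\<And>n. norm (x n) = 1" "weakly_null x"
    using normalized_weakly_null_exists[OF assms(1-3)] by blast
  have "semi_normalized x" unfolding semi_normalized_def using x(1) by (intro exI[of _ 1]) auto
  then obtain \<sigma> c where \<sigma>: "strict_mono \<sigma>" "c > 0"
    "\<And>A. finite A \<Longrightarrow> (\<forall>j\<in>A. card A \<le> j) \<Longrightarrow> c * real (card A) powr (1 / p) \<le> norm (\<Sum>j\<in>A. x (\<sigma> j))"
    using cbs[unfolded co_banach_saks_def, rule_format, of x] x(2) by blast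
  show ?thesis
  proof (rule that[of "\<lambda>n. x (\<sigma> n)" c])
    show "weakly_null (\<lambda>n. x (\<sigma> n))" using x(2) \<sigma>(1) by (rule weakly_null_subseq)
  qed (use x(1) \<sigma> in auto)
qed

lemma negative_powr_small:
  fixes B \<epsilon> \<gamma> :: real
  assumes "\<gamma> < 0" "\<epsilon> > 0"
  obtains k :: nat where "k > 0" "B * real k powr \<gamma> \<le> \<epsilon>"
proof -
  have "((\<lambda>k. B * real k powr \<gamma>) \<longlongrightarrow> B * 0) sequentially"
    using assms by (intro tendsto_mult tendsto_const tendsto_neg_powr filterlim_real_sequentially)
  hence "\<forall>\<^sub>F k in sequentially. B * real k powr \<gamma> < \<epsilon>" using assms by (intro order_tendstoD) auto
  hence "\<forall>\<^sub>F k in sequentially. k > 0 \<and> B * real k powr \<gamma> < \<epsilon>"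
    by (intro eventually_conj eventually_gt_at_top)
  then obtain k where "k > 0 \<and> B * real k powr \<gamma> < \<epsilon>" by (auto dest: eventually_happens)
  thus ?thesis using that[of k] by simp
qed

text \<open>Moving the weakly null sequence into the finite-codimensional \<open>E\<close> found for the first
  coordinate must not spoil the lower estimate; this keeps \<open>c\<close> independent of \<open>E\<close>.\<close>

lemma weakly_null_into_fin_codim:
  fixes x :: "nat \<Rightarrow> 'a::banach" and E :: "'a set"
  assumes x: "\<And>n. norm (x n) = 1" "weakly_null x" and "c > 0" and "k > 0"
    and low: "\<And>A. finite A \<Longrightarrow> (\<And>j. j \<in> A \<Longrightarrow> card A \<le> j) \<Longrightarrow> c * real (card A) powr (1 / p) \<le> norm (\<Sum>j\<in>A. x j)"
    and E: "fin_codim_subspace E"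
  obtains y where "\<And>n. y n \<in> E" "\<And>n. norm (y n) \<le> 2" "weakly_null y"
    "\<And>l. length l = k \<Longrightarrow> distinct l \<Longrightarrow> (\<And>j. j \<in> set l \<Longrightarrow> k \<le> j) \<Longrightarrow>
       c / 2 * real k powr (1 / p) \<le> norm (sum_list (map y l))"
proof -
  obtain P where P: "bounded_linear P" "\<And>x. P x \<in> E" "(\<lambda>n. x n - P (x n)) \<longlonglongrightarrow> 0"
    using fin_codim_projection[OF E] x(2) unfolding weakly_null_def by metis
  \<comment> \<open>The \<open>k\<close> errors of size \<open>\<eta>\<close> use up at most half of
    the lower bound, and \<open>\<eta> \<le> 1\<close> keeps
    \<open>norm (y n) \<le> 2\<close>.\<close>
  define \<eta> where "\<eta> = min 1 (c * real k powr (1 / p) / (2 * real k))"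
  have \<eta>: "\<eta> > 0" "\<eta> \<le> 1" using \<open>c > 0\<close> \<open>k > 0\<close> by (auto simp: \<eta>_def)
  have "\<eta> \<le> c * real k powr (1 / p) / (2 * real k)" by (simp add: \<eta>_def)
  hence k\<eta>: "real k * \<eta> \<le> c / 2 * real k powr (1 / p)" using \<open>k > 0\<close> by (simp add: field_simps)
  have "\<forall>\<^sub>F n in sequentially. norm (x n - P (x n)) < \<eta>"
    using tendstoD[OF P(3) \<eta>(1)] by (simp add: dist_norm)
  then obtain N where N: "\<And>n. n \<ge> N \<Longrightarrow> norm (x n - P (x n)) < \<eta>" by (auto simp: eventually_sequentially)
  define y where "y n = P (x (n + N))" for n
  have close: "norm (x (n + N) - y n) \<le> \<eta>" for n using N[of "n + N"] by (simp add: y_def less_imp_le)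
  show ?thesis
  proof (rule that)
    show "y n \<in> E" for n using P(2) by (simp add: y_def)
    show "norm (y n) \<le> 2" for n
      using close[of n] x(1)[of "n + N"] norm_triangle_ineq2[of "y n" "x (n + N)"] \<eta>(2)
      by (simp add: norm_minus_commute)
    show "weakly_null y"
      unfolding weakly_null_def
    proof
      fix g :: "'a \<Rightarrow>\<^sub>L real"
      have "bounded_linear (\<lambda>z. blinfun_apply g (P z))"
        using bounded_linear_compose[OF blinfun.bounded_linear_right P(1)] .
      hence "(\<lambda>n. blinfun_apply g (P (x n))) \<longlonglongrightarrow> 0"
        using x(2)[unfolded weakly_null_def, rule_format, of "Blinfun (\<lambda>z. blinfun_apply g (P z))"]
        by (simp add: bounded_linear_Blinfun_apply)
      thus "(\<lambda>n. blinfun_apply g (y n)) \<longlonglongrightarrow> 0"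
        unfolding y_def by (rule LIMSEQ_ignore_initial_segment)
    qed
  next
    fix l assume l: "length l = k" "distinct l" "\<And>j. j \<in> set l \<Longrightarrow> k \<le> j"
    have card: "card (set l) = k" using l by (simp add: distinct_card)
    \<comment> \<open>Shifting indices upward preserves the condition \<open>card A \<le> j\<close>,
      so the tail of the sequence keeps its lower estimate.\<close>
    let ?A = "(\<lambda>j. j + N) ` set l"
    have cA: "card ?A = k" using card by (subst card_image) (auto simp: inj_on_def)
    have "c * real (card ?A) powr (1 / p) \<le> norm (\<Sum>j\<in>?A. x j)"
      unfolding cA[symmetric] using l(3) cA by (intro low) fastforce+
    also have "(\<Sum>j\<in>?A. x j) = (\<Sum>j\<in>set l. x (j + N))" by (subst sum.reindex) (auto simp: inj_on_def)
    also have "\<dots> = (\<Sum>j\<in>set l. y j) + (\<Sum>j\<in>set l. x (j + N) - y j)" by (simp flip: sum.distrib)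
    also have "norm \<dots> \<le> norm (\<Sum>j\<in>set l. y j) + norm (\<Sum>j\<in>set l. x (j + N) - y j)" by (rule norm_triangle_ineq)
    also have "norm (\<Sum>j\<in>set l. x (j + N) - y j) \<le> (\<Sum>j\<in>set l. \<eta>)" using close by (intro sum_norm_le)
    also have "\<dots> = real k * \<eta>" using card by simp
    finally have "c * real k powr (1 / p) \<le> norm (\<Sum>j\<in>set l. y j) + real k * \<eta>" by (simp add: cA)
    moreover have "(\<Sum>j\<in>set l. y j) = sum_list (map y l)" using l(2) by (simp add: sum_list_distinct_conv_sum_set)
    ultimately show "c / 2 * real k powr (1 / p) \<le> norm (sum_list (map y l))" using k\<eta> by simp
  qed
qed

lemma powr_le_imp_le_root:
  fixes z w r :: real
  assumes "z powr r \<le> w" "0 \<le> z" "0 < r"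
  shows "z \<le> w powr (1 / r)"
proof -
  have "z = (z powr r) powr (1 / r)" using assms by (simp add: powr_powr)
  also have "\<dots> \<le> w powr (1 / r)" using assms by (intro powr_mono2) auto
  finally show ?thesis .
qed

lemma ultrafilter_sum_bound:
  fixes y :: "nat \<Rightarrow> 'a::real_normed_vector"
  assumes step: "\<forall>(F::nat filter) (s::'a) d. (\<forall>g::'a \<Rightarrow>\<^sub>L real. ((\<lambda>n. blinfun_apply g (d n)) \<longlongrightarrow> 0) F) \<longrightarrow>
      (\<forall>n. norm (d n) \<le> 1) \<longrightarrow> (\<forall>\<^sub>F n in F. norm (s + d n) powr p \<le> norm s powr p + C)"
    and y: "\<And>n. norm (y n) \<le> 2" "\<And>g::'a \<Rightarrow>\<^sub>L real. ((\<lambda>n. blinfun_apply g (y n)) \<longlongrightarrow> 0) F"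
    and p: "0 < p"
  shows "iter_ev F k (\<lambda>l. norm (sum_list (map y l)) \<le> 2 * (real k * C) powr (1 / p))"
proof -
  \<comment> \<open>Halving brings \<open>y\<close> into the unit ball required by
    \<open>step\<close>; the factor 2 in the conclusion undoes it.\<close>
  have "\<forall>\<^sub>F n in F. norm (s + y n /\<^sub>R 2) powr p \<le> norm s powr p + C" for s
  proof (rule step[rule_format])
    fix g :: "'a \<Rightarrow>\<^sub>L real"
    show "((\<lambda>n. blinfun_apply g (y n /\<^sub>R 2)) \<longlongrightarrow> 0) F"
      using tendsto_mult_left[OF y(2)[of g], of "1 / 2"] by (simp add: blinfun.scaleR_right)
  qed (use y(1) in simp)
  hence "iter_ev F k (\<lambda>l. norm (0 + sum_list (map (\<lambda>n. y n /\<^sub>R 2) l)) powr p \<le> norm (0::'a) powr p + real k * C)"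
    by (rule iter_ev_upper_estimate)
  thus ?thesis
  proof (rule iter_ev_mono)
    fix l assume "norm (0 + sum_list (map (\<lambda>n. y n /\<^sub>R 2) l)) powr p \<le> norm (0::'a) powr p + real k * C"
    moreover have "sum_list (map (\<lambda>n. y n /\<^sub>R 2) l) = sum_list (map y l) /\<^sub>R 2"
      by (induction l) (simp_all add: scaleR_right_distrib)
    ultimately have "norm (sum_list (map y l) /\<^sub>R 2) powr p \<le> real k * C" by simp
    hence "norm (sum_list (map y l) /\<^sub>R 2) \<le> (real k * C) powr (1 / p)"
      using p by (intro powr_le_imp_le_root) auto
    thus "norm (sum_list (map y l)) \<le> 2 * (real k * C) powr (1 / p)" by simp
  qed
qed

text \<open>Changing one entry of the list moves the argument by at most \<open>4 * r\<close> and
  its image by at most \<open>4 * L * r + L\<close>, which is at most \<open>5 * L * r\<close> since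
  \<open>r \<ge> 1\<close>. Dividing by that number makes the concentration inequality
  applicable.\<close>

lemma coarse_lipschitz_sum_concentration:
  fixes f :: "'a::real_normed_vector \<Rightarrow> 'b::real_normed_vector"
  assumes refl: "reflexive TYPE('b::real_normed_vector)" and F: "free_ultrafilter F"
    and step: "\<forall>(F::nat filter) (s::'b) d. (\<forall>g::'b \<Rightarrow>\<^sub>L real. ((\<lambda>n. blinfun_apply g (d n)) \<longlongrightarrow> 0) F) \<longrightarrow>
      (\<forall>n. norm (d n) \<le> 1) \<longrightarrow> (\<forall>\<^sub>F n in F. norm (s + d n) powr q \<le> norm s powr q + D)"
    and q: "0 < q" and L: "L > 0" and up: "\<And>x y. norm (f x - f y) \<le> L * norm (x - y) + L"
    and y: "\<And>n. norm (y n) \<le> 2" and r: "1 \<le> r"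
  shows "\<exists>z. iter_ev F k (\<lambda>l. norm (f (u + r *\<^sub>R sum_list (map y l)) - z) \<le> 5 * L * r * (real k * D) powr (1 / q))"
proof -
  define \<psi> where "\<psi> l = u + r *\<^sub>R sum_list (map y l)" for l
  define M where "M = 5 * L * r"
  have M: "M > 0" using L r by (simp add: M_def)
  have lip: "norm (f (\<psi> (xs @ n # ys)) /\<^sub>R M - f (\<psi> (xs @ m # ys)) /\<^sub>R M) \<le> 1" for xs ys n m
  proof -
    have "\<psi> (xs @ n # ys) - \<psi> (xs @ m # ys) = r *\<^sub>R (y n - y m)" by (simp add: \<psi>_def algebra_simps)
    moreover have "norm (y n - y m) \<le> 4" using y[of n] y[of m] norm_triangle_ineq4[of "y n" "y m"] by simp
    ultimately have "norm (\<psi> (xs @ n # ys) - \<psi> (xs @ m # ys)) \<le> r * 4" using r by simp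
    hence "L * norm (\<psi> (xs @ n # ys) - \<psi> (xs @ m # ys)) + L \<le> L * (r * 4) + L * r"
      using L r by (intro add_mono mult_left_mono) auto
    hence le: "norm (f (\<psi> (xs @ n # ys)) - f (\<psi> (xs @ m # ys))) \<le> M"
      using up[of "\<psi> (xs @ n # ys)" "\<psi> (xs @ m # ys)"] by (simp add: M_def)
    have "norm (s /\<^sub>R M - t /\<^sub>R M) = norm (s - t) / M" for s t :: 'b
      using M by (simp add: divide_inverse mult.commute flip: scaleR_right_diff_distrib)
    thus ?thesis using M le by simp
  qed
  obtain z where z: "\<And>s. iter_ev F k (\<lambda>l. norm (s + (f (\<psi> l) /\<^sub>R M - z)) powr q \<le> norm s powr q + real k * D)"
    using reflexive_concentration[OF refl F step[rule_format], of k "\<lambda>l. f (\<psi> l) /\<^sub>R M"] lip by blast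
  have "iter_ev F k (\<lambda>l. norm (f (\<psi> l) - M *\<^sub>R z) \<le> M * (real k * D) powr (1 / q))"
    using z[of 0]
  proof (rule iter_ev_mono)
    fix l assume "norm (0 + (f (\<psi> l) /\<^sub>R M - z)) powr q \<le> norm (0::'b) powr q + real k * D"
    hence "norm (f (\<psi> l) /\<^sub>R M - z) \<le> (real k * D) powr (1 / q)"
      using q by (intro powr_le_imp_le_root) auto
    hence "M * norm (f (\<psi> l) /\<^sub>R M - z) \<le> M * (real k * D) powr (1 / q)" using M by simp
    also have "M * norm (f (\<psi> l) /\<^sub>R M - z) = norm (M *\<^sub>R (f (\<psi> l) /\<^sub>R M - z))" using M by simp
    also have "M *\<^sub>R (f (\<psi> l) /\<^sub>R M - z) = f (\<psi> l) - M *\<^sub>R z" using M by (simp add: scaleR_right_diff_distrib)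
    finally show "norm (f (\<psi> l) - M *\<^sub>R z) \<le> M * (real k * D) powr (1 / q)" .
  qed
  thus ?thesis unfolding \<psi>_def M_def by blast
qed

theorem theorem5p6:
  fixes q1 p q2 :: real
    and e :: "nat \<Rightarrow> 'y1::banach"
  assumes "1 \<le> q1" and "q1 < p" and "p < q2"
    and "infinite_dimensional TYPE('x::banach)"
    and "asymptotically_uniformly_smooth_power TYPE('x) p"
    and "co_banach_saks TYPE('x) p"
    and "\<not> contains_l1 TYPE('x)"
    and "one_unconditional_basis e"
    and "lower_estimate_const1 e q1"
    and "reflexive TYPE('y2::banach)"
    and "asymptotically_uniformly_smooth_power TYPE('y2) q2"
  shows "\<not> (\<exists>f :: 'x \<Rightarrow> 'y1 \<times> 'y2. coarse_lipschitz_embedding f)"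
proof
  assume "\<exists>f :: 'x \<Rightarrow> 'y1 \<times> 'y2. coarse_lipschitz_embedding f"
  then obtain f :: "'x \<Rightarrow> 'y1 \<times> 'y2" and L where L: "L > 0"
    and up: "\<And>x y. norm (f x - f y) \<le> L * norm (x - y) + L"
    and lo: "\<And>x y. norm (x - y) / L - L \<le> norm (f x - f y)"
    by (metis coarse_lipschitz_embeddingE)
  have up1: "norm (fst (f x) - fst (f y)) \<le> L * norm (x - y) + L" for x y
  proof -
    have "norm (fst (f x - f y)) \<le> norm (f x - f y)" by (metis norm_fst_le prod.collapse)
    thus ?thesis using up[of x y] by simp
  qed
  have up2: "norm (snd (f x) - snd (f y)) \<le> L * norm (x - y) + L" for x y
  proof -
    have "norm (snd (f x - f y)) \<le> norm (f x - f y)" by (metis norm_snd_le prod.collapse)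
    thus ?thesis using up[of x y] by simp
  qed
  have p: "p > 1" and q2: "1 \<le> q2" using assms(1-3) by auto
  have e: "schauder_basis e" using assms(8) by (simp add: one_unconditional_basis_def)
  obtain x :: "nat \<Rightarrow> 'x" and c where x: "\<And>n. norm (x n) = 1" "weakly_null x" and c: "c > 0"
    "\<And>A. finite A \<Longrightarrow> (\<And>j. j \<in> A \<Longrightarrow> card A \<le> j) \<Longrightarrow> c * real (card A) powr (1 / p) \<le> norm (\<Sum>j\<in>A. x j)"
    using co_banach_saks_sequence[OF assms(4,5) p assms(6)] by blast
  obtain C where C: "C > 0" "\<forall>(F::nat filter) (s::'x) d. (\<forall>g::'x \<Rightarrow>\<^sub>L real. ((\<lambda>n. blinfun_apply g (d n)) \<longlongrightarrow> 0) F) \<longrightarrow>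
      (\<forall>n. norm (d n) \<le> 1) \<longrightarrow> (\<forall>\<^sub>F n in F. norm (s + d n) powr p \<le> norm s powr p + C)"
    using asym_smooth_filter_step[OF assms(5) less_imp_le[OF p]] by blast
  obtain D where D: "D > 0" "\<forall>(F::nat filter) (s::'y2) d. (\<forall>g::'y2 \<Rightarrow>\<^sub>L real. ((\<lambda>n. blinfun_apply g (d n)) \<longlongrightarrow> 0) F) \<longrightarrow>
      (\<forall>n. norm (d n) \<le> 1) \<longrightarrow> (\<forall>\<^sub>F n in F. norm (s + d n) powr q2 \<le> norm s powr q2 + D)"
    using asym_smooth_filter_step[OF assms(11) q2] by blast
  obtain F where F: "free_ultrafilter F" using free_ultrafilter_exists by blast
  hence F0: "F \<noteq> bot" and Fseq: "F \<le> sequentially" by (auto simp: free_ultrafilter_def)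

  \<comment> \<open>The choice of constants and scales\<close>
  define a where "a = C powr (1 / p)"
  have a: "a > 0" using C by (simp add: a_def)
  \<comment> \<open>Four errors of size \<open>\<epsilon> * \<tau>\<close> will amount to half of
    the separation \<open>\<tau> * c / (8 * a * L)\<close> reached at the end.\<close>
  define \<epsilon> where "\<epsilon> = c / (64 * a * L)"
  have \<epsilon>: "\<epsilon> > 0" using a L c by (simp add: \<epsilon>_def)
  have "1 / q2 - 1 / p < 0" using p assms(3) by (simp add: field_simps)
  \<comment> \<open>The bounded quantity is the concentration error of the second coordinate divided
    by \<open>\<tau>\<close>. It does not involve \<open>E\<close> or \<open>\<tau>\<close>, so
    \<open>k\<close> can be fixed before them.\<close>
  then obtain k :: nat where k: "k > 0"
    "(5 * L / (2 * a) * D powr (1 / q2)) * real k powr (1 / q2 - 1 / p) \<le> \<epsilon>"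
    using \<epsilon> by (rule negative_powr_small)
  define \<kappa> where "\<kappa> = real k powr (1 / p)"
  have \<kappa>: "\<kappa> > 0" using k by (simp add: \<kappa>_def)
  \<comment> \<open>The first bound on \<open>\<tau>\<close> gives \<open>r > 1\<close>; the second
    defeats the additive constant \<open>L\<close> in the final inequality.\<close>
  obtain u \<tau> E A where \<tau>: "max (2 * a * \<kappa>) (16 * a * L * L / c) < \<tau>" "0 < \<tau>" and E: "fin_codim_subspace E"
    and A: "finite A" "\<And>h. h \<in> E \<Longrightarrow> norm h \<le> \<tau> \<Longrightarrow> \<exists>b\<in>A. norm (fst (f (u + h)) - b) \<le> \<epsilon> * \<tau>"
    using coarse_lipschitz_flat_on_fin_codim[OF L up1 assms(5) e assms(9,1,2) \<epsilon>, of "max (2 * a * \<kappa>) (16 * a * L * L / c)"]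
    by blast
  obtain y where y: "\<And>n. y n \<in> E" "\<And>n. norm (y n) \<le> 2" "weakly_null y"
    and ylow: "\<And>l. length l = k \<Longrightarrow> distinct l \<Longrightarrow> (\<And>j. j \<in> set l \<Longrightarrow> k \<le> j) \<Longrightarrow> c / 2 * \<kappa> \<le> norm (sum_list (map y l))"
    using weakly_null_into_fin_codim[OF x c(1) k(1) c(2) E] unfolding \<kappa>_def by blast
  have ywn: "((\<lambda>n. blinfun_apply g (y n)) \<longlongrightarrow> 0) F" for g :: "'x \<Rightarrow>\<^sub>L real"
    using y(3) Fseq unfolding weakly_null_def by (blast intro: tendsto_mono)
  \<comment> \<open>Generic sums have norm at most \<open>2 * a * \<kappa>\<close>, so
    \<open>r\<close> scales them into the ball of radius \<open>\<tau>\<close>.\<close>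
  define r where "r = \<tau> / (2 * a * \<kappa>)"
  have r: "r > 1" "r * (2 * a * \<kappa>) = \<tau>" using \<tau> a \<kappa> by (auto simp: r_def field_simps)
  let ?S = "\<lambda>l. sum_list (map y l)"
  let ?\<psi> = "\<lambda>l. u + r *\<^sub>R ?S l"

  \<comment> \<open>Concentration of both coordinates\<close>
  have SE: "?S l \<in> E" for l
    using y(1) E by (induction l) (auto simp: fin_codim_subspace_def subspace_0 subspace_add)
  have "iter_ev F k (\<lambda>l. norm (?S l) \<le> 2 * (real k * C) powr (1 / p))"
    using ultrafilter_sum_bound[OF C(2) y(2) ywn] p by simp
  hence upper: "iter_ev F k (\<lambda>l. norm (r *\<^sub>R ?S l) \<le> \<tau>)"
  proof (rule iter_ev_mono)
    fix l assume "norm (?S l) \<le> 2 * (real k * C) powr (1 / p)"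
    also have "\<dots> = 2 * a * \<kappa>" by (simp add: \<kappa>_def a_def powr_mult)
    finally have "r * norm (?S l) \<le> r * (2 * a * \<kappa>)" using r by (intro mult_left_mono) auto
    thus "norm (r *\<^sub>R ?S l) \<le> \<tau>" using r by simp
  qed
  hence cover: "iter_ev F k (\<lambda>l. \<exists>b\<in>A. norm (fst (f (?\<psi> l)) - b) \<le> \<epsilon> * \<tau>)"
    by (rule iter_ev_mono) (use A(2) SE E in \<open>simp add: fin_codim_subspace_def subspace_scale\<close>)
  obtain b where b: "iter_ev F k (\<lambda>l. norm (fst (f (?\<psi> l)) - b) \<le> \<epsilon> * \<tau>)"
    using iter_ev_finite_cover[where P = "\<lambda>b l. norm (fst (f (?\<psi> l)) - b) \<le> \<epsilon> * \<tau>", OF F A(1) cover] by blast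

  obtain z where "iter_ev F k (\<lambda>l. norm (snd (f (?\<psi> l)) - z) \<le> 5 * L * r * (real k * D) powr (1 / q2))"
    using coarse_lipschitz_sum_concentration[where f = "\<lambda>x. snd (f x)" and y = y and r = r and k = k and u = u,
        OF assms(10) F D(2) _ L up2 y(2)] r(1) q2 by auto
  moreover have "5 * L * r * (real k * D) powr (1 / q2) \<le> \<epsilon> * \<tau>"
  proof -
    have "real k powr (1 / q2) = real k powr (1 / q2 - 1 / p) * \<kappa>" by (simp add: \<kappa>_def flip: powr_add)
    hence "5 * L * r * (real k * D) powr (1 / q2)
        = (5 * L / (2 * a) * D powr (1 / q2)) * real k powr (1 / q2 - 1 / p) * \<tau>"
      using a by (simp add: powr_mult r(2)[symmetric])
    also have "\<dots> \<le> \<epsilon> * \<tau>" using k(2) \<tau>(2) by (intro mult_right_mono) auto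
    finally show ?thesis .
  qed
  ultimately have z: "iter_ev F k (\<lambda>l. norm (snd (f (?\<psi> l)) - z) \<le> \<epsilon> * \<tau>)"
    by (auto elim: iter_ev_mono)

  \<comment> \<open>Two generic lists with distant values\<close>
  have good: "iter_ev F k (\<lambda>l. norm (fst (f (?\<psi> l)) - b) \<le> \<epsilon> * \<tau> \<and> norm (snd (f (?\<psi> l)) - z) \<le> \<epsilon> * \<tau>)"
    using b z by (rule iter_ev_conj)
  obtain l where l: "length l = k" "norm (fst (f (?\<psi> l)) - b) \<le> \<epsilon> * \<tau>" "norm (snd (f (?\<psi> l)) - z) \<le> \<epsilon> * \<tau>"
    "distinct l" "\<forall>j\<in>set l. k \<le> j"
    using iter_ev_ex[OF F0 iter_ev_conj[OF good iter_ev_distinct_ge[OF Fseq, of k k]]] by blast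
  have Sl: "c / 2 * \<kappa> \<le> norm (?S l)" using l by (intro ylow) auto
  obtain g :: "'x \<Rightarrow>\<^sub>L real" where g: "\<And>w. \<bar>blinfun_apply g w\<bar> \<le> norm w" "blinfun_apply g (?S l) = norm (?S l)"
    using norming_functional by blast
  have "c / 4 * \<kappa> > 0" using c \<kappa> by simp
  \<comment> \<open>With \<open>l\<close> fixed, \<open>m\<close> is also generic for the functional
    norming \<open>?S l\<close>, which on \<open>?S m\<close> takes less than half of its value at
    \<open>?S l\<close>. The co-Banach-Saks bound for \<open>?S l\<close> alone thus separates the
    two sums.\<close>
  then obtain m where m: "norm (fst (f (?\<psi> m)) - b) \<le> \<epsilon> * \<tau>" "norm (snd (f (?\<psi> m)) - z) \<le> \<epsilon> * \<tau>"
    "\<bar>blinfun_apply g (?S m)\<bar> < c / 4 * \<kappa>"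
    using iter_ev_ex[OF F0 iter_ev_conj[OF good iter_ev_functional_small[OF ywn[of g]]]] by blast
  have "c / 4 * \<kappa> \<le> norm (?S l - ?S m)"
    using g(1)[of "?S l - ?S m"] g(2) Sl m(3) unfolding blinfun.diff_right by linarith
  hence "r * (c / 4 * \<kappa>) \<le> r * norm (?S l - ?S m)" using r by (intro mult_left_mono) auto
  also have "r * (c / 4 * \<kappa>) = \<tau> * c / (8 * a)" using a by (simp add: r(2)[symmetric])
  also have "r * norm (?S l - ?S m) = norm (?\<psi> l - ?\<psi> m)"
    using r by (simp add: scaleR_right_diff_distrib[symmetric])
  finally have "\<tau> * c / (8 * a) / L - L \<le> norm (?\<psi> l - ?\<psi> m) / L - L"
    using L by (intro diff_right_mono divide_right_mono) auto
  also have "\<dots> \<le> norm (f (?\<psi> l) - f (?\<psi> m))" by (rule lo)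
  also have "\<dots> \<le> norm (fst (f (?\<psi> l)) - fst (f (?\<psi> m))) + norm (snd (f (?\<psi> l)) - snd (f (?\<psi> m)))"
    using norm_Pair_le[of "fst (f (?\<psi> l) - f (?\<psi> m))" "snd (f (?\<psi> l) - f (?\<psi> m))"]
    by (simp only: prod.collapse fst_diff[symmetric] snd_diff[symmetric])
  also have "\<dots> \<le> (\<epsilon> * \<tau> + \<epsilon> * \<tau>) + (\<epsilon> * \<tau> + \<epsilon> * \<tau>)"
    using l(2,3) m(1,2) norm_triangle_ineq4[of "fst (f (?\<psi> l)) - b" "fst (f (?\<psi> m)) - b"]
      norm_triangle_ineq4[of "snd (f (?\<psi> l)) - z" "snd (f (?\<psi> m)) - z"] by simp
  also have "\<dots> = \<tau> * c / (16 * a * L)" by (simp add: \<epsilon>_def)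
  finally have "\<tau> * c / (8 * a * L) - L \<le> \<tau> * c / (16 * a * L)" by simp
  moreover have "\<tau> * c / (8 * a * L) = 2 * (\<tau> * c / (16 * a * L))" by simp
  ultimately have "\<tau> * c / (16 * a * L) \<le> L" by linarith
  hence "\<tau> \<le> 16 * a * L * L / c" using a L c(1) by (simp add: field_simps)
  thus False using \<tau>(1) by simp
qed

end
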